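(* Let $G$ be a partial 2-tree (a graph of treewidth at most 2). Then $G$ is $C_5$-induced-minor-free if and only if $\mathsf{mtw}(G) \le 2$.
   Context: $C_5$ is the 5-cycle. A graph $F$ is an induced minor of $G$ if $F$ can be obtained from an induced subgraph of $G$ by contracting edges; $G$ is $F$-induced-minor-free if $F$ is not an induced minor of $G$. A tree decomposition of $G$ is a tree with bags $B(t)\subseteq V(G)$ such that every edge lies in some bag and, for each vertex, the bags containing it form a nonempty connected subtree; width is maximum bag size minus one. A bag is matched if the subgraph of $G$ induced by the bag has a perfect matching, or has a matching leaving exactly one vertex $v$ of the bag unmatched with $v$ adjacent to some matched vertex. $\mathsf{mtw}(G)$ is the minimum width of a tree decomposition all of whose bags are matched.
   Formalization: The formal theorem additionally assumes that G has no isolated vertices; a graph with an isolated vertex (e.g. K_1) has no tree decomposition with all bags matched, so mtw(G) is undefined and the literal equivalence fails there. *)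

theory Defs
  imports "Graph_Theory.Graph_Theory" "HOL-Library.Extended_Nat"
begin

text \<open>
  Finite simple graphs are the symmetric loop-free pair digraphs of \<^locale>\<open>pair_graph\<close>: an
  undirected edge \<open>uv\<close> is the pair of arcs \<open>(u, v)\<close> and \<open>(v, u)\<close>.
\<close>

definition cycle_graph :: "nat \<Rightarrow> nat pair_pre_digraph" where
  "cycle_graph n = \<lparr> pverts = {0..<n},
     parcs = {(i, j). i < n \<and> j < n \<and> (j = (i + 1) mod n \<or> i = (j + 1) mod n)} \<rparr>"

abbreviation C5 :: "nat pair_pre_digraph" where
  "C5 \<equiv> cycle_graph 5"


text \<open>The vertex obtained by contracting \<open>uv\<close> is called \<open>u\<close>; loops are dropped, and parallel
  arcs cannot arise.\<close>

definition contract_edge :: "'a pair_pre_digraph \<Rightarrow> 'a \<Rightarrow> 'a \<Rightarrow> 'a pair_pre_digraph" where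
  "contract_edge G u v =
     (let f = (\<lambda>x. if x = v then u else x)
      in \<lparr> pverts = pverts G - {v},
           parcs = {(f x, f y) |x y. (x, y) \<in> parcs G \<and> f x \<noteq> f y} \<rparr>)"

definition contraction_step :: "'a pair_pre_digraph \<Rightarrow> 'a pair_pre_digraph \<Rightarrow> bool" where
  "contraction_step G H \<longleftrightarrow> (\<exists>(u, v) \<in> parcs G. H = contract_edge G u v)"

definition induced_minor :: "'b pair_pre_digraph \<Rightarrow> 'a pair_pre_digraph \<Rightarrow> bool" where
  "induced_minor F G \<longleftrightarrow>
     (\<exists>K H. induced_subgraph (with_proj K) (with_proj G) \<and>
            contraction_step\<^sup>*\<^sup>* K H \<and>
            digraph_iso (with_proj H) (with_proj F))"

definition induced_minor_free :: "'b pair_pre_digraph \<Rightarrow> 'a pair_pre_digraph \<Rightarrow> bool" where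
  "induced_minor_free F G \<longleftrightarrow> \<not> induced_minor F G"


text \<open>
  The library constant \<^const>\<open>tree\<close> is not usable here: \<^const>\<open>pre_digraph.cycle\<close> counts an edge
  traversed back and forth as a cycle of length 2. Cycles of length at least 3 are exactly the
  cycles of the undirected graph. \<^const>\<open>connected\<close> includes non-emptiness.
\<close>

definition undirected_tree :: "'a pair_pre_digraph \<Rightarrow> bool" where
  "undirected_tree T \<longleftrightarrow> pair_graph T \<and> connected (with_proj T) \<and>
     \<not> (\<exists>p. pre_digraph.cycle (with_proj T) p \<and> 3 \<le> length p)"

definition tree_decomposition ::
    "'a pair_pre_digraph \<Rightarrow> nat pair_pre_digraph \<Rightarrow> (nat \<Rightarrow> 'a set) \<Rightarrow> bool" where
  "tree_decomposition G T B \<longleftrightarrow>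
     undirected_tree T \<and>
     (\<forall>t \<in> pverts T. B t \<subseteq> pverts G) \<and>
     (\<forall>(u, v) \<in> parcs G. \<exists>t \<in> pverts T. u \<in> B t \<and> v \<in> B t) \<and>
     (\<forall>v \<in> pverts G. connected (with_proj T \<restriction> {t \<in> pverts T. v \<in> B t}))"

text \<open>The truncated subtraction only matters for the graph without vertices.\<close>

definition width :: "nat pair_pre_digraph \<Rightarrow> (nat \<Rightarrow> 'a set) \<Rightarrow> nat" where
  "width T B = (MAX t \<in> pverts T. card (B t)) - 1"

definition treewidth :: "'a pair_pre_digraph \<Rightarrow> enat" where
  "treewidth G = (INF (T, B) \<in> {(T, B). tree_decomposition G T B}. enat (width T B))"

definition partial_2_tree :: "'a pair_pre_digraph \<Rightarrow> bool" where
  "partial_2_tree G \<longleftrightarrow> pair_graph G \<and> treewidth G \<le> 2"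


definition matching :: "('a, 'b) pre_digraph \<Rightarrow> 'a set set \<Rightarrow> bool" where
  "matching H M \<longleftrightarrow> M \<subseteq> {{u, v} |u v. u \<rightarrow>\<^bsub>H\<^esub> v} \<and> (\<forall>e \<in> M. \<forall>f \<in> M. e \<noteq> f \<longrightarrow> e \<inter> f = {})"

definition matched_bag :: "'a pair_pre_digraph \<Rightarrow> 'a set \<Rightarrow> bool" where
  "matched_bag G X \<longleftrightarrow>
     (\<exists>M. matching (with_proj G \<restriction> X) M \<and>
          (\<Union>M = X \<or>
           (\<exists>v \<in> X. \<Union>M = X - {v} \<and> (\<exists>w \<in> \<Union>M. v \<rightarrow>\<^bsub>with_proj G\<^esub> w))))"

definition matched_tree_decomposition ::
    "'a pair_pre_digraph \<Rightarrow> nat pair_pre_digraph \<Rightarrow> (nat \<Rightarrow> 'a set) \<Rightarrow> bool" where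
  "matched_tree_decomposition G T B \<longleftrightarrow>
     tree_decomposition G T B \<and> (\<forall>t \<in> pverts T. matched_bag G (B t))"

definition mtw :: "'a pair_pre_digraph \<Rightarrow> enat" where
  "mtw G = (INF (T, B) \<in> {(T, B). matched_tree_decomposition G T B}. enat (width T B))"

definition no_isolated_vertices :: "'a pair_pre_digraph \<Rightarrow> bool" where
  "no_isolated_vertices G \<longleftrightarrow> (\<forall>v \<in> pverts G. \<exists>w. (v, w) \<in> parcs G)"

text \<open>A matched tree decomposition, and hence the minimum defining \<^const>\<open>mtw\<close>, can only exist
  in the absence of isolated vertices.\<close>

lemma matched_tree_decomposition_imp_no_isolated_vertices:
  assumes G: "pair_graph G" and D: "matched_tree_decomposition G T B"
  shows "no_isolated_vertices G"
  unfolding no_isolated_vertices_def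
proof
  interpret pair_graph G by (fact G)
  fix v assume v: "v \<in> pverts G"
  have "connected (with_proj T \<restriction> {t \<in> pverts T. v \<in> B t})"
    using D v by (auto simp: matched_tree_decomposition_def tree_decomposition_def)
  then have "{t \<in> pverts T. v \<in> B t} \<noteq> {}"
    by (auto simp: connected_def strongly_connected_def)
  then obtain t where t: "t \<in> pverts T" "v \<in> B t" by blast
  then have "matched_bag G (B t)"
    using D by (simp add: matched_tree_decomposition_def)
  then obtain M where M: "matching (with_proj G \<restriction> B t) M"
    and c: "\<Union>M = B t \<or> (\<exists>x \<in> B t. \<Union>M = B t - {x} \<and> (\<exists>w \<in> \<Union>M. (x, w) \<in> parcs G))"
    unfolding matched_bag_def with_proj_simps by (elim exE conjE) (rule that)
  show "\<exists>w. (v, w) \<in> parcs G"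
  proof (cases "v \<in> \<Union>M")
    case True
    then obtain e where e: "e \<in> M" "v \<in> e" by blast
    have "e \<in> {{x, y} |x y. (x, y) \<in> arcs_ends (with_proj G \<restriction> B t)}"
      using M e(1) by (simp add: matching_def subset_iff)
    then obtain x y where xy: "e = {x, y}" "(x, y) \<in> arcs_ends (with_proj G \<restriction> B t)"
      by blast
    then have "(x, y) \<in> parcs G" by (auto simp: arcs_ends_conv)
    then have "(x, y) \<in> parcs G" "(y, x) \<in> parcs G"
      by (simp_all add: arcs_symmetric)
    then show ?thesis using e(2) xy(1) by auto
  next
    case False
    with t(2) have "\<Union>M \<noteq> B t" by metis
    with c obtain x w where "\<Union>M = B t - {x}" "(x, w) \<in> parcs G" by metis
    with False t(2) show ?thesis by (cases "v = x") auto
  qed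
qed

end

theory Submission
  imports Defs
begin

text \<open>
  A bag of at most three vertices is matched iff it is empty or induces a connected graph with at
  least two vertices.

  If all bags are of this kind and \<open>C\<^sub>5\<close> were an induced minor with branch sets \<open>V\<^sub>0, \<dots>, V\<^sub>4\<close>, the sets
  \<open>V\<^sub>i \<union> V\<^sub>i\<^sub>+\<^sub>1\<close> would form a bramble, so some bag meets all of them. Such a bag consists of one vertex
  in each of \<open>V\<^sub>c, V\<^sub>c\<^sub>+\<^sub>2, V\<^sub>c\<^sub>+\<^sub>3\<close> for some \<open>c\<close>, and the first is not adjacent to the other two.

  Conversely, induct on the number of vertices and take a vertex \<open>v\<close> of degree at most two, which exists
  since the treewidth is at most two. The only difficult case is that \<open>v\<close> has two nonadjacent
  neighbours \<open>a, b\<close>. A component \<open>D\<close> of \<open>G - {v, a, b}\<close> that does not attach to both of them is split off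
  at a cut vertex. Otherwise \<open>D\<close> contains a common neighbour \<open>c\<close> of \<open>a\<close> and \<open>b\<close>, since there is no induced
  \<open>C\<^sub>5\<close> minor through \<open>v\<close>, and \<open>c\<close> separates \<open>a\<close> from \<open>b\<close> in \<open>G[D \<union> {a, b}]\<close>, since there is no \<open>K\<^sub>4\<close>
  minor. The two sides of \<open>c\<close> are decomposed inductively and joined by the bag \<open>{a, b, c}\<close>, and all
  components are joined along \<open>{a, b}\<close> to the bag \<open>{v, a, b}\<close>.
\<close>

section \<open>Connected vertex sets\<close>

text \<open>Walks have to stay inside \<open>S\<close>, and the empty set counts as connected; so
  fibres over non-vertices and empty bags need no special case.\<close>

definition connected_in :: "('a \<times> 'a) set \<Rightarrow> 'a set \<Rightarrow> bool" where
  "connected_in E S \<longleftrightarrow> (\<forall>x\<in>S. \<forall>y\<in>S. (x, y) \<in> (Restr E S)\<^sup>*)"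

definition component :: "('a \<times> 'a) set \<Rightarrow> 'a set \<Rightarrow> 'a \<Rightarrow> 'a set" where
  "component E S x = (Restr E S)\<^sup>* `` {x}"

lemma connected_inI_hub:
  assumes "sym E" "\<And>y. y \<in> S \<Longrightarrow> (x, y) \<in> (Restr E S)\<^sup>*"
  shows "connected_in E S"
proof -
  have "sym ((Restr E S)\<^sup>*)"
    using assms(1) by (intro sym_rtrancl) (auto simp: sym_def)
  with assms(2) show ?thesis
    unfolding connected_in_def by (meson rtrancl_trans symD)
qed

lemma connected_in_mono:
  assumes "connected_in E S" "Restr E S \<subseteq> F"
  shows "connected_in F S"
proof -
  have "Restr E S \<subseteq> Restr F S"
    using assms(2) by auto
  then show ?thesis
    using assms(1) rtrancl_mono unfolding connected_in_def by blast
qed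

lemma connected_in_empty [simp]: "connected_in E {}"
  and connected_in_singleton [simp]: "connected_in E {x}"
  by (auto simp: connected_in_def)

lemma connected_in_edge:
  assumes "sym E" "(x, y) \<in> E"
  shows "connected_in E {x, y}"
  using assms by (intro connected_inI_hub[of E _ x]) (auto intro: r_into_rtrancl)

lemma connected_in_path3:
  assumes "sym E" "(x, y) \<in> E" "(x, z) \<in> E"
  shows "connected_in E {x, y, z}"
  using assms by (intro connected_inI_hub[of E _ x]) (auto intro: r_into_rtrancl)

lemma connected_in_Un:
  assumes "sym E" "connected_in E S" "connected_in E T"
    and touch: "x \<in> S" "y \<in> T" "x = y \<or> (x, y) \<in> E"
  shows "connected_in E (S \<union> T)"
proof (rule connected_inI_hub[OF assms(1), of _ x])
  have S: "(Restr E S)\<^sup>* \<subseteq> (Restr E (S \<union> T))\<^sup>*" and T: "(Restr E T)\<^sup>* \<subseteq> (Restr E (S \<union> T))\<^sup>*"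
    by (rule rtrancl_mono; blast)+
  have xy: "(x, y) \<in> (Restr E (S \<union> T))\<^sup>*"
    using touch by auto
  fix z assume "z \<in> S \<union> T"
  then show "(x, z) \<in> (Restr E (S \<union> T))\<^sup>*"
  proof
    assume "z \<in> S"
    then have "(x, z) \<in> (Restr E S)\<^sup>*" using assms(2) touch(1) by (auto simp: connected_in_def)
    then show ?thesis using S by blast
  next
    assume "z \<in> T"
    then have "(y, z) \<in> (Restr E T)\<^sup>*" using assms(3) touch(2) by (auto simp: connected_in_def)
    then show ?thesis using T xy by (meson rtrancl_trans subsetD)
  qed
qed

text \<open>The induction along the walk keeps an alternative: either it has stayed in
  \<open>T\<close> so far, or its first arc \<open>(p, q)\<close> out of \<open>T\<close> has
  already been found.\<close>

lemma rtrancl_Restr_exit: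
  assumes "(x, y) \<in> (Restr E S)\<^sup>*" "x \<in> T" "y \<notin> T"
  obtains p q where "(x, p) \<in> (Restr E (S \<inter> T))\<^sup>*" "p \<in> S \<inter> T" "q \<in> S - T" "(p, q) \<in> E"
proof -
  have "((x, y) \<in> (Restr E (S \<inter> T))\<^sup>* \<and> y \<in> T) \<or>
     (\<exists>p q. (x, p) \<in> (Restr E (S \<inter> T))\<^sup>* \<and> p \<in> S \<inter> T \<and> q \<in> S - T \<and> (p, q) \<in> E)"
    using assms(1)
  proof (induction rule: rtrancl_induct)
    case base then show ?case using assms(2) by blast
  next
    case (step y z)
    show ?case
    proof (cases "(x, y) \<in> (Restr E (S \<inter> T))\<^sup>* \<and> y \<in> T")
      case True
      show ?thesis
      proof (cases "z \<in> T")
        case True': True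
        then have "(y, z) \<in> Restr E (S \<inter> T)" using step True by auto
        then show ?thesis using True True' by (meson rtrancl.rtrancl_into_rtrancl)
      next
        case False
        then show ?thesis using step True by blast
      qed
    next
      case False
      then show ?thesis using step by blast
    qed
  qed
  then show ?thesis using assms(3) that by blast
qed

text \<open>The walk from \<open>x\<close> to \<open>y\<close> must leave \<open>T\<close>.
  Recording that \<open>p\<close> lies in the component of \<open>x\<close> in
  \<open>S \<inter> T\<close> makes this the tool for finding an edge that leaves a
  component.\<close>

lemma connected_in_exit:
  assumes "connected_in E S" "x \<in> S" "y \<in> S" "x \<in> T" "y \<notin> T"
  shows "\<exists>p \<in> component E (S \<inter> T) x. \<exists>q \<in> S - T. p \<in> S \<inter> T \<and> (p, q) \<in> E"
proof -
  have "(x, y) \<in> (Restr E S)\<^sup>*"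
    using assms by (simp add: connected_in_def)
  then obtain p q where "(x, p) \<in> (Restr E (S \<inter> T))\<^sup>*" "p \<in> S \<inter> T" "q \<in> S - T" "(p, q) \<in> E"
    using assms(4,5) by (rule rtrancl_Restr_exit)
  then show ?thesis
    unfolding component_def by blast
qed

section \<open>Components of an induced subgraph\<close>

lemma component_self [simp]: "x \<in> component E S x"
  by (simp add: component_def)

lemma component_subset: "x \<in> S \<Longrightarrow> component E S x \<subseteq> S"
  unfolding component_def by (auto elim: rtranclE)

lemma component_closed:
  assumes "p \<in> component E S x" "(p, q) \<in> E" "p \<in> S" "q \<in> S"
  shows "q \<in> component E S x"
  using assms unfolding component_def by (auto intro: rtrancl.rtrancl_into_rtrancl)

lemma component_connected:
  assumes "sym E"
  shows "connected_in E (component E S x)"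
proof (rule connected_inI_hub[OF assms, of _ x])
  fix y assume "y \<in> component E S x"
  then have "(x, y) \<in> (Restr E S)\<^sup>*" by (simp add: component_def)
  then show "(x, y) \<in> (Restr E (component E S x))\<^sup>*"
  proof (induction rule: rtrancl_induct)
    case (step y z)
    then have "y \<in> component E S x" "z \<in> component E S x"
      by (auto simp: component_def intro: rtrancl.rtrancl_into_rtrancl)
    with step show ?case by (auto intro: rtrancl.rtrancl_into_rtrancl)
  qed auto
qed

lemma component_sym:
  assumes "sym E" "y \<in> component E S x"
  shows "x \<in> component E S y"
proof -
  have "sym ((Restr E S)\<^sup>*)"
    using assms(1) by (intro sym_rtrancl) (auto simp: sym_def)
  then show ?thesis using assms(2) by (auto simp: component_def dest: symD)
qed

section \<open>Hypergraphs with the running intersection property\<close>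

text \<open>Listing the nodes of a tree decomposition so that each node is a leaf of the tree spanned by
  it and its predecessors, the predicate records only the set of bags; no tree is needed
  to state that a family of bags comes from a tree decomposition.\<close>

inductive rip :: "'a set \<Rightarrow> 'a set set \<Rightarrow> bool" where
  single: "rip B {B}"
| add: "rip V \<B> \<Longrightarrow> X \<in> \<B> \<Longrightarrow> B \<inter> V \<subseteq> X \<Longrightarrow> rip (V \<union> B) (insert B \<B>)"

lemma rip_Union: "rip V \<B> \<Longrightarrow> \<Union>\<B> = V"
  by (induction rule: rip.induct) auto

lemma rip_nonempty: "rip V \<B> \<Longrightarrow> \<B> \<noteq> {}"
  by (induction rule: rip.induct) auto

text \<open>In tree terms, an edge is added between the nodes of \<open>X\<close> and
  \<open>X'\<close>. If \<open>X\<close> is not the last bag \<open>B\<close>, then \<open>B\<close>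
  is put back after gluing; if \<open>X\<close> is \<open>B\<close> itself, \<open>B\<close> is
  first hung below \<open>X'\<close> and then serves as the gluing bag for the older family.\<close>

lemma rip_glue:
  assumes "rip V \<B>" "rip V' \<B>'" "X \<in> \<B>" "X' \<in> \<B>'" "V \<inter> V' \<subseteq> X \<inter> X'"
  shows "rip (V \<union> V') (\<B> \<union> \<B>')"
  using assms
proof (induction arbitrary: V' \<B>' X X' rule: rip.induct)
  case (single B)
  then show ?case using rip.add[of V' \<B>' X' B] by (auto simp: Un_commute)
next
  case (add V \<B> Y B)
  note V = rip_Union[OF add.hyps(1)]
  show ?case
  proof (cases "X \<in> \<B>")
    case True
    then have "rip (V \<union> V') (\<B> \<union> \<B>')"
      using add.prems by (intro add.IH[of V' \<B>' X X']) auto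
    moreover have "B \<inter> (V \<union> V') \<subseteq> Y"
      using add.prems add.hyps True V by blast
    ultimately have "rip (V \<union> V' \<union> B) (insert B (\<B> \<union> \<B>'))"
      using add.hyps by (intro rip.add[of _ _ Y]) auto
    then show ?thesis by (simp add: Un_ac)
  next
    case False
    then have [simp]: "X = B" using add.prems by auto
    have "rip (V' \<union> B) (insert B \<B>')"
      using add.prems by (intro rip.add[of _ _ X']) auto
    then have "rip (V \<union> (V' \<union> B)) (\<B> \<union> insert B \<B>')"
      using add.prems add.hyps by (intro add.IH[of _ _ Y B]) auto
    then show ?thesis by (simp add: Un_ac)
  qed
qed

lemma rip_restrict: "rip V \<B> \<Longrightarrow> rip (V \<inter> W) ((\<lambda>B. B \<inter> W) ` \<B>)"
proof (induction rule: rip.induct)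
  case (add V \<B> X B)
  then have "rip (V \<inter> W \<union> B \<inter> W) (insert (B \<inter> W) ((\<lambda>B. B \<inter> W) ` \<B>))"
    by (intro rip.add[of _ _ "X \<inter> W"]) auto
  then show ?case by (simp add: Int_Un_distrib2)
qed (auto intro: rip.single)

text \<open>A vertex private to the last bag works. If there is none, the last bag lies inside the
  bag it was attached to and cannot spoil the vertex found before. In a decomposition of a graph all
  neighbours of \<open>v\<close> then lie in \<open>B\<close>, which bounds its degree.\<close>

lemma rip_simplicial:
  assumes "rip V \<B>" "V \<noteq> {}"
  obtains v B where "v \<in> V" "B \<in> \<B>" "v \<in> B" "\<And>B'. B' \<in> \<B> \<Longrightarrow> v \<in> B' \<Longrightarrow> B' \<subseteq> B"
proof -
  have "\<exists>v\<in>V. \<exists>B\<in>\<B>. v \<in> B \<and> (\<forall>B'\<in>\<B>. v \<in> B' \<longrightarrow> B' \<subseteq> B)"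
    using assms
  proof (induction rule: rip.induct)
    case (add V \<B> X B)
    note V = rip_Union[OF add.hyps(1)]
    show ?case
    proof (cases "B \<subseteq> V")
      case True
      then obtain v B0 where "v \<in> V" "B0 \<in> \<B>" "v \<in> B0" "\<forall>B'\<in>\<B>. v \<in> B' \<longrightarrow> B' \<subseteq> B0"
        using add by (metis sup.absorb1)
      moreover have "B \<subseteq> X" using True add.hyps by blast
      ultimately show ?thesis using add.hyps by (intro bexI[of _ v] bexI[of _ B0]) auto
    next
      case False
      then obtain v where "v \<in> B" "v \<notin> V" by blast
      then show ?thesis using V by blast
    qed
  qed auto
  then show ?thesis using that by metis
qed

text \<open>The graph, with loops, in which every bag is a clique; a family of bags covers the edges
  of a graph iff the arcs lie in this relation.\<close>

definition cohabit :: "'a set set \<Rightarrow> ('a \<times> 'a) set" where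
  "cohabit \<B> = {(x, y). \<exists>B\<in>\<B>. x \<in> B \<and> y \<in> B}"

text \<open>The easy half of the duality between tree decompositions and brambles.\<close>

lemma rip_bramble:
  assumes "rip V \<B>"
    and "\<And>S. S \<in> \<S> \<Longrightarrow> S \<noteq> {} \<and> S \<subseteq> V \<and> connected_in (cohabit \<B>) S"
    and "\<And>S T. S \<in> \<S> \<Longrightarrow> T \<in> \<S> \<Longrightarrow> \<exists>x\<in>S. \<exists>y\<in>T. (x, y) \<in> cohabit \<B>"
  shows "\<exists>B\<in>\<B>. \<forall>S\<in>\<S>. S \<inter> B \<noteq> {}"
  using assms
proof (induction arbitrary: \<S> rule: rip.induct)
  case (single B)
  have "S \<inter> B \<noteq> {}" if "S \<in> \<S>" for S
    using single.prems(1)[OF that] by auto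
  then show ?case by simp
next
  case (add V \<B> X B)
  note V = rip_Union[OF add.hyps(1)]
  let ?c = "cohabit (insert B \<B>)"
  show ?case
  proof (cases "\<exists>S\<in>\<S>. S \<inter> V = {}")
    case True
    then obtain S where S: "S \<in> \<S>" "S \<inter> V = {}" by blast
    have "T \<inter> B \<noteq> {}" if T: "T \<in> \<S>" for T
    proof -
      obtain x y where "x \<in> S" "y \<in> T" "(x, y) \<in> ?c"
        using add.prems(2)[OF S(1) T] by blast
      then show ?thesis using S V by (auto simp: cohabit_def)
    qed
    then show ?thesis by blast
  next
    case meets: False
    \<comment> \<open>Inside \<open>S\<close>, a step from outside \<open>V\<close> into
      \<open>V\<close> joins two vertices sharing \<open>B\<close>, and the second of them lies in
      \<open>V \<inter> B\<close>.\<close>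
    have inter: "\<exists>z\<in>S \<inter> V. z \<in> B" if S: "S \<in> \<S>" and x: "x \<in> S" "x \<in> B" for S x
    proof (cases "x \<in> V")
      case True
      then show ?thesis using x by blast
    next
      case False
      obtain y where y: "y \<in> S" "y \<in> V" using meets S by blast
      obtain p q where "p \<in> S \<inter> - V" "q \<in> S - (- V)" "(p, q) \<in> ?c"
        using connected_in_exit[of ?c S x y "- V"] add.prems(1)[OF S] x y False by blast
      then show ?thesis using V by (auto simp: cohabit_def)
    qed
    have conn: "connected_in (cohabit \<B>) (S \<inter> V)" if S: "S \<in> \<S>" for S
      unfolding connected_in_def
    proof (intro ballI)
      fix x y assume x: "x \<in> S \<inter> V" and y: "y \<in> S \<inter> V"
      let ?r = "(Restr (cohabit \<B>) (S \<inter> V))\<^sup>*"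
      have "(x, y) \<in> (Restr ?c S)\<^sup>*"
        using add.prems(1)[OF S] x y by (auto simp: connected_in_def)
      \<comment> \<open>Excursions of the walk outside \<open>V\<close> stay in \<open>B\<close> and
        begin and end in \<open>V \<inter> B\<close>, hence in \<open>X\<close>, where they can be
        shortcut. The second conjunct remembers a vertex from which the shortcut can start.\<close>
      then have "(y \<in> V \<longrightarrow> (x, y) \<in> ?r) \<and> (y \<in> B \<longrightarrow> (\<exists>z\<in>S \<inter> V \<inter> B. (x, z) \<in> ?r))"
      proof (induction rule: rtrancl_induct)
        case base
        then show ?case using x by blast
      next
        case (step y z)
        have yS: "y \<in> S" "z \<in> S" using step by auto
        have hop: "(x, w) \<in> ?r" if "(x, u) \<in> ?r" "u \<in> S \<inter> V" "w \<in> S \<inter> V" "(u, w) \<in> cohabit \<B>" for u w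
          using that rtrancl.rtrancl_into_rtrancl[of x u "Restr (cohabit \<B>) (S \<inter> V)" w] by blast
        consider C where "C \<in> \<B>" "y \<in> C" "z \<in> C" | "y \<in> B" "z \<in> B"
          using step.hyps by (auto simp: cohabit_def)
        then show ?case
        proof cases
          case 1
          then have "y \<in> V" "z \<in> V" "(y, z) \<in> cohabit \<B>" using V by (auto simp: cohabit_def)
          then have "(x, z) \<in> ?r" using hop[of y z] step.IH yS by auto
          then show ?thesis using yS \<open>z \<in> V\<close> by blast
        next
          case 2
          then obtain u where u: "u \<in> S \<inter> V \<inter> B" "(x, u) \<in> ?r" using step.IH by blast
          then have "z \<in> V \<Longrightarrow> (u, z) \<in> cohabit \<B>"
            using add.hyps 2 by (auto simp: cohabit_def)
          then show ?thesis using u hop[of u z] yS 2 by blast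
        qed
      qed
      then show "(x, y) \<in> ?r" using y by blast
    qed
    have touch: "\<exists>x\<in>S. \<exists>y\<in>T. (x, y) \<in> cohabit \<B>" if S: "S \<in> (\<lambda>S. S \<inter> V) ` \<S>" and T: "T \<in> (\<lambda>S. S \<inter> V) ` \<S>" for S T
    proof -
      obtain S' T' where ST: "S' \<in> \<S>" "S = S' \<inter> V" "T' \<in> \<S>" "T = T' \<inter> V" using S T by blast
      obtain x y where xy: "x \<in> S'" "y \<in> T'" "(x, y) \<in> ?c"
        using add.prems(2)[OF ST(1,3)] by blast
      consider C where "C \<in> \<B>" "x \<in> C" "y \<in> C" | "x \<in> B" "y \<in> B"
        using xy by (auto simp: cohabit_def)
      then show ?thesis
      proof cases
        case 1
        then show ?thesis using xy ST V by (auto simp: cohabit_def)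
      next
        case 2
        obtain z w where "z \<in> S' \<inter> V" "z \<in> B" "w \<in> T' \<inter> V" "w \<in> B"
          using inter[OF ST(1) xy(1) 2(1)] inter[OF ST(3) xy(2) 2(2)] by blast
        then show ?thesis using ST add.hyps by (auto simp: cohabit_def)
      qed
    qed
    have "\<exists>B\<in>\<B>. \<forall>S\<in>(\<lambda>S. S \<inter> V) ` \<S>. S \<inter> B \<noteq> {}"
    proof (rule add.IH)
      fix S assume "S \<in> (\<lambda>S. S \<inter> V) ` \<S>"
      then show "S \<noteq> {} \<and> S \<subseteq> V \<and> connected_in (cohabit \<B>) S"
        using meets conn by auto
    qed (rule touch)
    then obtain C where "C \<in> \<B>" "\<forall>S\<in>\<S>. S \<inter> V \<inter> C \<noteq> {}" by auto
    then show ?thesis by (intro bexI[of _ C]) auto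
  qed
qed

section \<open>Induced minors as vertex maps\<close>

lemma pair_graph_iff:
  "pair_graph K \<longleftrightarrow> finite (pverts K) \<and> parcs K \<subseteq> pverts K \<times> pverts K \<and> sym (parcs K) \<and> irrefl (parcs K)"
proof
  assume "pair_graph K"
  then interpret pair_graph K .
  show "finite (pverts K) \<and> parcs K \<subseteq> pverts K \<times> pverts K \<and> sym (parcs K) \<and> irrefl (parcs K)"
    using sym_arcs by (auto simp: symmetric_def irrefl_def dest: in_arcsD1 in_arcsD2 pair_no_loops)
next
  assume K: "finite (pverts K) \<and> parcs K \<subseteq> pverts K \<times> pverts K \<and> sym (parcs K) \<and> irrefl (parcs K)"
  then have "finite (parcs K)"
    by (meson finite_SigmaI finite_subset)
  with K show "pair_graph K"
    by unfold_locales (auto simp: symmetric_def irrefl_def)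
qed

lemma pair_graph_imp_wf_digraph:
  assumes "pair_graph K"
  shows "wf_digraph (with_proj K)"
proof -
  interpret pair_graph K by fact
  show ?thesis by (rule wf_digraph)
qed

text \<open>The fibres of \<open>f\<close> on \<open>U\<close> are the branch sets of an induced
  minor model: the third condition forbids extra edges between them, the fourth provides all
  required ones, and the image condition makes the one of each vertex of \<open>F\<close>
  nonempty.\<close>

definition minor_map :: "('a \<times> 'a) set \<Rightarrow> 'a set \<Rightarrow> 'b pair_pre_digraph \<Rightarrow> ('a \<Rightarrow> 'b) \<Rightarrow> bool" where
  "minor_map E U F f \<longleftrightarrow> f ` U = pverts F \<and> (\<forall>i. connected_in E {x \<in> U. f x = i}) \<and>
     (\<forall>x\<in>U. \<forall>y\<in>U. (x, y) \<in> E \<longrightarrow> f x \<noteq> f y \<longrightarrow> (f x, f y) \<in> parcs F) \<and>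
     (\<forall>i j. (i, j) \<in> parcs F \<longrightarrow> (\<exists>x\<in>U. \<exists>y\<in>U. (x, y) \<in> E \<and> f x = i \<and> f y = j))"

lemma minor_mapD:
  assumes "minor_map E U F f"
  shows "f ` U = pverts F" "connected_in E {x \<in> U. f x = i}"
    "x \<in> U \<Longrightarrow> y \<in> U \<Longrightarrow> (x, y) \<in> E \<Longrightarrow> f x \<noteq> f y \<Longrightarrow> (f x, f y) \<in> parcs F"
    "(i, j) \<in> parcs F \<Longrightarrow> \<exists>x\<in>U. \<exists>y\<in>U. (x, y) \<in> E \<and> f x = i \<and> f y = j"
  using assms unfolding minor_map_def by blast+

lemma minor_map_Restr: "minor_map (Restr E U) U F f \<longleftrightarrow> minor_map E U F f"
proof -
  have "Restr (Restr E U) {x \<in> U. f x = i} = Restr E {x \<in> U. f x = i}" for i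
    by auto
  then show ?thesis
    unfolding minor_map_def connected_in_def by auto
qed

definition merge :: "'a \<Rightarrow> 'a \<Rightarrow> 'a \<Rightarrow> 'a" where
  "merge u v x = (if x = v then u else x)"

lemma contract_edge_simps:
  "pverts (contract_edge K u v) = pverts K - {v}"
  "parcs (contract_edge K u v) =
     {(merge u v x, merge u v y) |x y. (x, y) \<in> parcs K \<and> merge u v x \<noteq> merge u v y}"
  by (simp_all add: contract_edge_def merge_def)

lemma pair_graph_contract_edge:
  assumes "pair_graph K" "(u, v) \<in> parcs K"
  shows "pair_graph (contract_edge K u v)"
proof -
  have K: "finite (pverts K)" "parcs K \<subseteq> pverts K \<times> pverts K" "sym (parcs K)" "u \<noteq> v"
    using assms unfolding pair_graph_iff by (auto simp: irrefl_def)
  have m: "merge u v x \<in> pverts K - {v}" if "x \<in> pverts K" for x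
    using that K(2,4) assms(2) by (auto simp: merge_def)
  have "sym (parcs (contract_edge K u v))"
    unfolding contract_edge_simps using K(3) by (auto simp: sym_def) metis
  moreover have "parcs (contract_edge K u v) \<subseteq> (pverts K - {v}) \<times> (pverts K - {v})"
    unfolding contract_edge_simps using K(2) m by blast
  moreover have "irrefl (parcs (contract_edge K u v))"
    unfolding contract_edge_simps by (auto simp: irrefl_def)
  ultimately show ?thesis
    unfolding pair_graph_iff using K(1) by (simp add: contract_edge_simps)
qed

text \<open>An arc of the contracted graph comes from an arc of \<open>K\<close> whose ends may be
  renamed, and a renamed vertex is joined to its new name by the edge \<open>uv\<close> inside the
  same fibre. So walks in the fibres lift to \<open>K\<close>.\<close>

lemma minor_map_uncontract:
  assumes K: "pair_graph K" and uv: "(u, v) \<in> parcs K"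
    and f: "minor_map (parcs (contract_edge K u v)) (pverts (contract_edge K u v)) F f"
  shows "minor_map (parcs K) (pverts K) F (f \<circ> merge u v)"
proof -
  let ?g = "merge u v" and ?E = "parcs K" and ?E' = "parcs (contract_edge K u v)"
  let ?V = "pverts K"
  have V: "?E \<subseteq> ?V \<times> ?V" "sym ?E" "u \<noteq> v" "u \<in> ?V" "v \<in> ?V"
    using K uv unfolding pair_graph_iff by (auto simp: irrefl_def)
  have g: "?g x \<in> ?V - {v}" if "x \<in> ?V" for x
    using that V by (auto simp: merge_def)
  have gg: "?g x = x" if "x \<noteq> v" for x
    using that by (simp add: merge_def)
  have "connected_in ?E {x \<in> ?V. f (?g x) = i}" for i
    unfolding connected_in_def
  proof (intro ballI)
    let ?P = "{x \<in> ?V. f (?g x) = i}" and ?A = "{x \<in> ?V - {v}. f x = i}"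
    let ?R = "(Restr ?E ?P)\<^sup>*"
    have "sym ?R"
      using V(2) by (intro sym_rtrancl) (auto simp: sym_def)
    have up: "(x, ?g x) \<in> ?R" if "x \<in> ?P" for x
    proof (cases "x = v")
      case True
      then have "(v, u) \<in> Restr ?E ?P"
        using that V uv by (auto simp: merge_def dest: symD)
      then have "(v, u) \<in> ?R" by (rule r_into_rtrancl)
      then show ?thesis using True by (metis merge_def)
    qed (simp add: merge_def)
    then have down: "(?g x, x) \<in> ?R" if "x \<in> ?P" for x
      using that \<open>sym ?R\<close> by (blast dest: symD)
    have "(p, q) \<in> ?R" if "(p, q) \<in> (Restr ?E' ?A)\<^sup>*" for p q
      using that
    proof (induction rule: rtrancl_induct)
      case (step q r)
      then obtain x y where xy: "q = ?g x" "r = ?g y" "(x, y) \<in> ?E"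
        unfolding contract_edge_simps by blast
      then have P: "x \<in> ?P" "y \<in> ?P"
        using step.hyps V(1) by auto
      then have "(x, y) \<in> ?R" using xy by blast
      then have "(q, r) \<in> ?R"
        using down[OF P(1)] up[OF P(2)] xy by (meson rtrancl_trans)
      with step.IH show ?case by (rule rtrancl_trans)
    qed simp
    moreover fix x y assume xy: "x \<in> ?P" "y \<in> ?P"
    moreover have "(?g x, ?g y) \<in> (Restr ?E' ?A)\<^sup>*"
      using minor_mapD(2)[OF f, of i] xy g unfolding connected_in_def
      by (simp add: contract_edge_simps(1))
    ultimately show "(x, y) \<in> ?R"
      using up[of x] down[of y] by (meson rtrancl_trans)
  qed
  moreover have "f ` ?g ` ?V = pverts F"
  proof -
    have "?g ` ?V = ?V - {v}"
      using g gg by (auto simp: image_iff) (metis)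
    then show ?thesis using minor_mapD(1)[OF f] by (simp add: contract_edge_simps(1))
  qed
  moreover have "(f (?g x), f (?g y)) \<in> parcs F"
    if "x \<in> ?V" "y \<in> ?V" "(x, y) \<in> ?E" "f (?g x) \<noteq> f (?g y)" for x y
  proof -
    have "(?g x, ?g y) \<in> ?E'"
      unfolding contract_edge_simps using that(3,4) by (intro CollectI exI[of _ x] exI[of _ y]) auto
    then show ?thesis
      using minor_mapD(3)[OF f] that g by (simp add: contract_edge_simps(1))
  qed
  moreover have "\<exists>x\<in>?V. \<exists>y\<in>?V. (x, y) \<in> ?E \<and> f (?g x) = i \<and> f (?g y) = j" if ij: "(i, j) \<in> parcs F" for i j
  proof -
    obtain p q where "(p, q) \<in> ?E'" "f p = i" "f q = j"
      using minor_mapD(4)[OF f ij] by blast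
    then show ?thesis
      unfolding contract_edge_simps using V(1) by blast
  qed
  ultimately show ?thesis
    unfolding minor_map_def by (simp add: image_comp)
qed

text \<open>Contracting inside a branch set keeps branch sets connected, as walks project. No arc
  required by \<open>F\<close> collapses: \<open>F\<close> has no loops, so the ends of such an arc
  lie in different fibres.\<close>

lemma minor_map_contract:
  assumes K: "pair_graph K" and uv: "(u, v) \<in> parcs K" "f u = f v"
    and f: "minor_map (parcs K) (pverts K) F f" and F: "irrefl (parcs F)"
  shows "minor_map (parcs (contract_edge K u v)) (pverts (contract_edge K u v)) F f"
proof -
  let ?g = "merge u v" and ?E = "parcs K" and ?E' = "parcs (contract_edge K u v)"
  let ?V = "pverts K"
  have V: "?E \<subseteq> ?V \<times> ?V" "sym ?E" "u \<noteq> v" "u \<in> ?V" "v \<in> ?V"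
    using K uv unfolding pair_graph_iff by (auto simp: irrefl_def)
  have g: "?g x \<in> ?V - {v}" if "x \<in> ?V" for x
    using that V by (auto simp: merge_def)
  have gg: "?g x = x" if "x \<noteq> v" for x
    using that by (simp add: merge_def)
  have fg: "f (?g x) = f x" for x
    using uv(2) by (simp add: merge_def)
  have arc: "(?g x, ?g y) \<in> ?E'" if "(x, y) \<in> ?E" "?g x \<noteq> ?g y" for x y
    unfolding contract_edge_simps using that by blast
  have "connected_in ?E' {x \<in> ?V - {v}. f x = i}" for i
    unfolding connected_in_def
  proof (intro ballI)
    let ?P = "{x \<in> ?V. f x = i}" and ?A = "{x \<in> ?V - {v}. f x = i}"
    fix x y assume xy: "x \<in> ?A" "y \<in> ?A"
    have "(x, y) \<in> (Restr ?E ?P)\<^sup>*"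
      using minor_mapD(2)[OF f, of i] xy by (simp add: connected_in_def)
    then have "(?g x, ?g y) \<in> (Restr ?E' ?A)\<^sup>*"
    proof (induction rule: rtrancl_induct)
      case (step y z)
      show ?case
      proof (cases "?g y = ?g z")
        case False
        then have "(?g y, ?g z) \<in> Restr ?E' ?A"
          using step.hyps arc g fg by simp
        with step.IH show ?thesis by (rule rtrancl.rtrancl_into_rtrancl)
      qed (use step.IH in simp)
    qed simp
    then show "(x, y) \<in> (Restr ?E' ?A)\<^sup>*"
      using xy gg by simp
  qed
  moreover have "f ` (?V - {v}) = pverts F"
  proof -
    have "f ` (?V - {v}) = f ` ?V"
      using V uv(2) by (auto simp: image_iff) (metis DiffI singletonD)
    then show ?thesis using minor_mapD(1)[OF f] by simp
  qed
  moreover have "(f p, f q) \<in> parcs F" if pq: "(p, q) \<in> ?E'" "f p \<noteq> f q" for p q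
  proof -
    obtain x y where "p = ?g x" "q = ?g y" "(x, y) \<in> ?E"
      using pq unfolding contract_edge_simps by blast
    then show ?thesis
      using minor_mapD(3)[OF f, of x y] pq(2) V(1) fg by auto
  qed
  moreover have "\<exists>p\<in>?V - {v}. \<exists>q\<in>?V - {v}. (p, q) \<in> ?E' \<and> f p = i \<and> f q = j" if ij: "(i, j) \<in> parcs F" "i \<noteq> j" for i j
  proof -
    obtain x y where xy: "x \<in> ?V" "y \<in> ?V" "(x, y) \<in> ?E" "f x = i" "f y = j"
      using minor_mapD(4)[OF f ij(1)] by blast
    then have "?g x \<noteq> ?g y" using fg ij(2) by metis
    then show ?thesis
      using xy g arc fg by blast
  qed
  moreover have "i \<noteq> j" if "(i, j) \<in> parcs F" for i j
    using that F by (auto simp: irrefl_def)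
  ultimately show ?thesis
    unfolding minor_map_def contract_edge_simps(1) by simp
qed

text \<open>An injective \<open>f\<close> has fibres of at most one vertex, which makes a minor map
  the same as an isomorphism.\<close>

lemma digraph_iso_iff_inj_minor_map:
  assumes H: "pair_graph H"
  shows "digraph_iso (with_proj H) (with_proj F) \<longleftrightarrow>
    (\<exists>f. inj_on f (pverts H) \<and> minor_map (parcs H) (pverts H) F f)"
proof
  have H': "parcs H \<subseteq> pverts H \<times> pverts H" "irrefl (parcs H)"
    using H unfolding pair_graph_iff by auto
  {
    assume "digraph_iso (with_proj H) (with_proj F)"
    then obtain h where h: "pre_digraph.digraph_isomorphism (with_proj H) h"
      and F_h: "with_proj F = app_iso h (with_proj H)"
      unfolding digraph_iso_def by blast
    let ?f = "iso_verts h"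
    have inj: "inj_on ?f (pverts H)"
      using h by (simp add: pre_digraph.digraph_isomorphism_def)
    have verts: "pverts F = ?f ` pverts H" and arcs: "parcs F = iso_arcs h ` parcs H"
      and ends: "iso_tail h = fst" "iso_head h = snd"
      using arg_cong[OF F_h, of verts] arg_cong[OF F_h, of arcs]
        arg_cong[OF F_h, of tail] arg_cong[OF F_h, of head] by auto
    have "iso_arcs h (x, y) = (?f x, ?f y)" if "(x, y) \<in> parcs H" for x y
      using h that unfolding pre_digraph.digraph_isomorphism_def with_proj_simps ends
      by (metis fst_conv snd_conv prod.collapse)
    then have arcs': "parcs F = (\<lambda>(x, y). (?f x, ?f y)) ` parcs H"
      unfolding arcs by (intro image_cong) auto
    have "connected_in (parcs H) {x \<in> pverts H. ?f x = i}" for i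
      using inj by (auto simp: connected_in_def inj_on_def)
    then have "minor_map (parcs H) (pverts H) F ?f"
      unfolding minor_map_def verts arcs' using H'(1) by fastforce
    with inj show "\<exists>f. inj_on f (pverts H) \<and> minor_map (parcs H) (pverts H) F f"
      by blast
  }
  {
    assume "\<exists>f. inj_on f (pverts H) \<and> minor_map (parcs H) (pverts H) F f"
    then obtain f where inj: "inj_on f (pverts H)" and f: "minor_map (parcs H) (pverts H) F f"
      by blast
    let ?h = "\<lparr>iso_verts = f, iso_arcs = \<lambda>(x, y). (f x, f y), iso_head = snd, iso_tail = fst\<rparr>"
    have "inj_on (\<lambda>(x, y). (f x, f y)) (parcs H)"
      using inj_on_subset[OF map_prod_inj_on[OF inj inj] H'(1)] by (simp add: map_prod_def)
    then have "pre_digraph.digraph_isomorphism (with_proj H) ?h"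
      unfolding pre_digraph.digraph_isomorphism_def
      using inj pair_graph_imp_wf_digraph[OF H] by auto
    moreover have "(\<lambda>(x, y). (f x, f y)) ` parcs H = parcs F"
    proof (intro subset_antisym subrelI)
      fix i j assume "(i, j) \<in> (\<lambda>(x, y). (f x, f y)) ` parcs H"
      then obtain x y where xy: "(x, y) \<in> parcs H" "i = f x" "j = f y" by auto
      then have "x \<in> pverts H" "y \<in> pverts H" "x \<noteq> y" using H' by (auto simp: irrefl_def)
      then show "(i, j) \<in> parcs F"
        using minor_mapD(3)[OF f] xy inj by (simp add: inj_on_eq_iff)
    next
      fix i j assume "(i, j) \<in> parcs F"
      then show "(i, j) \<in> (\<lambda>(x, y). (f x, f y)) ` parcs H"
        using minor_mapD(4)[OF f] by force
    qed
    then have "with_proj F = app_iso ?h (with_proj H)"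
      using minor_mapD(1)[OF f] by (simp add: with_proj_def app_iso_def)
    ultimately show "digraph_iso (with_proj H) (with_proj F)"
      unfolding digraph_iso_def by blast
  }
qed

lemma pair_graph_Restr:
  assumes "pair_graph G" "pverts K \<subseteq> pverts G" "parcs K = Restr (parcs G) (pverts K)"
  shows "pair_graph K"
  using assms unfolding pair_graph_iff by (auto simp: sym_def irrefl_def intro: finite_subset)

lemma induced_subgraph_with_proj_iff:
  assumes "pair_graph G"
  shows "induced_subgraph (with_proj K) (with_proj G) \<longleftrightarrow>
    pverts K \<subseteq> pverts G \<and> parcs K = Restr (parcs G) (pverts K)"
proof -
  interpret pair_graph G by fact
  have "pair_graph K" if "pverts K \<subseteq> pverts G" "parcs K = Restr (parcs G) (pverts K)"
    by (rule pair_graph_Restr[OF assms that])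
  then have "wf_digraph (with_proj K)" if "pverts K \<subseteq> pverts G" "parcs K = Restr (parcs G) (pverts K)"
    using that pair_graph_imp_wf_digraph by blast
  then show ?thesis
    unfolding induced_subgraph_def subgraph_def
    using wf_digraph by (auto simp: compatible_def)
qed

text \<open>Contractions are undone from the last to the first. The map changes with every one, so
  the induction statement quantifies over \<open>f\<close>.\<close>

lemma contraction_steps_minor_map:
  assumes "contraction_step\<^sup>*\<^sup>* K H" "pair_graph K" "minor_map (parcs H) (pverts H) F f"
  shows "\<exists>f. minor_map (parcs K) (pverts K) F f"
proof -
  have "pair_graph H \<and> (\<forall>f. minor_map (parcs H) (pverts H) F f \<longrightarrow> (\<exists>f. minor_map (parcs K) (pverts K) F f))"
    using assms(1)
  proof (induction rule: rtranclp_induct)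
    case base
    then show ?case using assms(2) by blast
  next
    case (step H H')
    then obtain u v where uv: "(u, v) \<in> parcs H" "H' = contract_edge H u v"
      by (auto simp: contraction_step_def)
    show ?case
    proof (intro conjI allI impI)
      show "pair_graph H'"
        using pair_graph_contract_edge step.IH uv by auto
      fix f assume "minor_map (parcs H') (pverts H') F f"
      then show "\<exists>f. minor_map (parcs K) (pverts K) F f"
        using minor_map_uncontract step.IH uv by metis
    qed
  qed
  then show ?thesis using assms(3) by blast
qed

text \<open>As long as \<open>f\<close> is not injective, some branch set has two vertices; being
  connected, it contains an edge, which is contracted. The map \<open>f\<close> stays the same
  throughout.\<close>

lemma minor_map_contraction_steps:
  assumes "pair_graph K" "minor_map (parcs K) (pverts K) F f" "irrefl (parcs F)"
  shows "\<exists>H. contraction_step\<^sup>*\<^sup>* K H \<and> pair_graph H \<and>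
    inj_on f (pverts H) \<and> minor_map (parcs H) (pverts H) F f"
  using assms
proof (induction "card (pverts K)" arbitrary: K rule: less_induct)
  case less
  show ?case
  proof (cases "inj_on f (pverts K)")
    case True
    then show ?thesis using less.prems by blast
  next
    case False
    then obtain x y where xy: "x \<in> pverts K" "y \<in> pverts K" "f x = f y" "x \<noteq> y"
      by (auto simp: inj_on_def)
    then have "(x, y) \<in> (Restr (parcs K) {z \<in> pverts K. f z = f x})\<^sup>*"
      using minor_mapD(2)[OF less.prems(2)] by (auto simp: connected_in_def)
    then obtain z where uv: "(x, z) \<in> parcs K" "f x = f z"
      using \<open>x \<noteq> y\<close> by (auto elim: converse_rtranclE)
    let ?K = "contract_edge K x z"
    have "finite (pverts K)" "z \<in> pverts K"
      using less.prems(1) uv unfolding pair_graph_iff by auto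
    then have "card (pverts ?K) < card (pverts K)"
      unfolding contract_edge_simps by (rule card_Diff1_less)
    then obtain H where "contraction_step\<^sup>*\<^sup>* ?K H" "pair_graph H" "inj_on f (pverts H)"
      "minor_map (parcs H) (pverts H) F f"
      using less.hyps minor_map_contract[OF less.prems(1) uv less.prems(2,3)]
        pair_graph_contract_edge[OF less.prems(1) uv(1)] less.prems(3) by blast
    moreover have "contraction_step K ?K"
      using uv(1) by (auto simp: contraction_step_def)
    ultimately show ?thesis
      by (meson converse_rtranclp_into_rtranclp)
  qed
qed

text \<open>The set \<open>U\<close> consists of the vertices of the induced subgraph, and the
  branch sets replace the contraction sequence. Only this form of induced minors is used
  later.\<close>

theorem induced_minor_iff_minor_map:
  assumes G: "pair_graph G" and F: "pair_graph F"
  shows "induced_minor F G \<longleftrightarrow> (\<exists>U f. U \<subseteq> pverts G \<and> minor_map (parcs G) U F f)"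
proof
  assume "induced_minor F G"
  then obtain K H where KH: "induced_subgraph (with_proj K) (with_proj G)"
    "contraction_step\<^sup>*\<^sup>* K H" "digraph_iso (with_proj H) (with_proj F)"
    unfolding induced_minor_def by blast
  then have K: "pverts K \<subseteq> pverts G" "parcs K = Restr (parcs G) (pverts K)"
    using induced_subgraph_with_proj_iff[OF G] by blast+
  have "pair_graph K"
    by (rule pair_graph_Restr[OF G K])
  moreover have "pair_graph H"
    using KH(2) \<open>pair_graph K\<close>
    by (induction rule: rtranclp_induct) (auto simp: contraction_step_def pair_graph_contract_edge)
  then obtain f where "minor_map (parcs H) (pverts H) F f"
    using KH(3) digraph_iso_iff_inj_minor_map by blast
  ultimately obtain f where "minor_map (parcs K) (pverts K) F f"
    using contraction_steps_minor_map[OF KH(2)] by blast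
  then show "\<exists>U f. U \<subseteq> pverts G \<and> minor_map (parcs G) U F f"
    using K minor_map_Restr by metis
next
  assume "\<exists>U f. U \<subseteq> pverts G \<and> minor_map (parcs G) U F f"
  then obtain U f where U: "U \<subseteq> pverts G" "minor_map (parcs G) U F f" by blast
  let ?K = "\<lparr>pverts = U, parcs = Restr (parcs G) U\<rparr>"
  have "pair_graph ?K"
    using U(1) by (intro pair_graph_Restr[OF G]) auto
  moreover have "minor_map (parcs ?K) (pverts ?K) F f"
    using U(2) minor_map_Restr by force
  moreover have "irrefl (parcs F)"
    using F unfolding pair_graph_iff by blast
  ultimately obtain H where "contraction_step\<^sup>*\<^sup>* ?K H" "pair_graph H" "inj_on f (pverts H)"
    "minor_map (parcs H) (pverts H) F f"
    using minor_map_contraction_steps by blast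
  moreover have "induced_subgraph (with_proj ?K) (with_proj G)"
    using U(1) induced_subgraph_with_proj_iff[OF G, of ?K] by simp
  ultimately show "induced_minor F G"
    unfolding induced_minor_def using digraph_iso_iff_inj_minor_map by blast
qed

section \<open>Trees and tree decompositions\<close>

lemma connected_induce_subgraph_iff:
  assumes "sym (parcs T)"
  shows "Digraph_Component.connected (with_proj T \<restriction> S) \<longleftrightarrow> S \<noteq> {} \<and> connected_in (parcs T) S"
proof -
  have ends: "symcl (arcs_ends (with_proj T \<restriction> S)) = Restr (parcs T) S"
    using assms by (auto simp: arcs_ends_conv symcl_def sym_def image_iff)
  have "(x, y) \<in> rtrancl_on S (Restr (parcs T) S) \<longleftrightarrow> (x, y) \<in> (Restr (parcs T) S)\<^sup>*"
    if "x \<in> S" "y \<in> S" for x y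
    using that rtrancl_consistent_rtrancl_on[of x y "Restr (parcs T) S" S]
      rtrancl_on_rtranclI[of x y S "Restr (parcs T) S"] by auto
  then show ?thesis
    unfolding connected_conv ends by (simp add: connected_in_def)
qed

section \<open>Walks as lists of arcs\<close>

lemma pcas_rtrancl: "pcas x p y \<Longrightarrow> set p \<subseteq> R \<Longrightarrow> (x, y) \<in> R\<^sup>*"
  by (induction p arbitrary: x) (auto intro: converse_rtrancl_into_rtrancl)

lemma pcas_append: "pcas x (p @ q) z \<longleftrightarrow> (\<exists>y. pcas x p y \<and> pcas y q z)"
  by (induction p arbitrary: x) auto

lemma pawalk_verts_append_single:
  "pcas x p y \<Longrightarrow> pawalk_verts x (p @ [(y, z)]) = pawalk_verts x p @ [z]"
  by (induction p arbitrary: x) auto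

lemma pawalk_verts_not_Nil [simp]: "pawalk_verts x p \<noteq> []"
  by (cases p) auto

lemma pawalk_verts_ends:
  "pcas x p y \<Longrightarrow> hd (pawalk_verts x p) = x \<and> last (pawalk_verts x p) = y"
  by (induction p arbitrary: x) auto

lemma arc_ends_in_pawalk_verts:
  "pcas x p y \<Longrightarrow> (u, v) \<in> set p \<Longrightarrow> u \<in> set (pawalk_verts x p) \<and> v \<in> set (tl (pawalk_verts x p))"
proof (induction p arbitrary: x)
  case (Cons e p)
  have "hd (pawalk_verts (snd e) p) = snd e"
    using pawalk_verts_ends[of "snd e" p y] Cons.prems(1) by auto
  then have "snd e \<in> set (pawalk_verts (snd e) p)"
    by (metis hd_in_set pawalk_verts_not_Nil)
  moreover have "set (tl (pawalk_verts (snd e) p)) \<subseteq> set (pawalk_verts (snd e) p)"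
    by (cases "pawalk_verts (snd e) p") auto
  ultimately show ?case
    using Cons by auto
qed simp

lemma pawalk_suffix:
  assumes "pcas x p y" "distinct (pawalk_verts x p)" "z \<in> set (pawalk_verts x p)"
  shows "\<exists>q. pcas z q y \<and> set q \<subseteq> set p \<and> distinct (pawalk_verts z q)"
  using assms
proof (induction p arbitrary: x)
  case (Cons e p)
  show ?case
  proof (cases "z = x")
    case True
    then show ?thesis using Cons.prems by blast
  next
    case False
    then have "\<exists>q. pcas z q y \<and> set q \<subseteq> set p \<and> distinct (pawalk_verts z q)"
      using Cons by auto
    then show ?thesis by auto
  qed
qed auto

lemma rtrancl_distinct_pawalk:
  assumes "(x, y) \<in> R\<^sup>*"
  shows "\<exists>p. pcas x p y \<and> set p \<subseteq> R \<and> distinct (pawalk_verts x p)"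
  using assms
proof (induction rule: converse_rtrancl_induct)
  case base
  then show ?case by (intro exI[of _ "[]"]) auto
next
  case (step x z)
  then obtain p where p: "pcas z p y" "set p \<subseteq> R" "distinct (pawalk_verts z p)" by blast
  show ?case
  proof (cases "x \<in> set (pawalk_verts z p)")
    case True
    then show ?thesis using pawalk_suffix[OF p(1,3)] p(2) by blast
  next
    case False
    then show ?thesis using p step.hyps by (intro exI[of _ "(x, z) # p"]) auto
  qed
qed

text \<open>For an edge \<open>st\<close> this says that it lies on no cycle. Non-reachability after
  deleting both arcs is easy to compare with routes in a tree and to maintain when a leaf is
  added.\<close>

definition bridge :: "('a \<times> 'a) set \<Rightarrow> 'a \<Rightarrow> 'a \<Rightarrow> bool" where
  "bridge E s t \<longleftrightarrow> (t, s) \<notin> (E - {(s, t), (t, s)})\<^sup>*"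

text \<open>The rest of a cycle of length at least 3 avoids both arcs of its first edge and bypasses
  it. Conversely, a bypass of a non-bridge can be taken to be a simple path, and the edge closes it
  to a cycle.\<close>

lemma undirected_tree_iff:
  "undirected_tree T \<longleftrightarrow> pair_graph T \<and> pverts T \<noteq> {} \<and> connected_in (parcs T) (pverts T) \<and>
     (\<forall>s t. (s, t) \<in> parcs T \<longrightarrow> bridge (parcs T) s t)"
proof (cases "pair_graph T")
  case True
  then interpret pair_graph T .
  have T: "sym (parcs T)" "parcs T \<subseteq> pverts T \<times> pverts T" "irrefl (parcs T)"
    using True unfolding pair_graph_iff by auto
  have "with_proj T \<restriction> pverts T = with_proj T"
    using T(2) by (auto simp: induce_subgraph_def with_proj_def)
  then have conn: "Digraph_Component.connected (with_proj T) \<longleftrightarrow> pverts T \<noteq> {} \<and> connected_in (parcs T) (pverts T)"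
    using connected_induce_subgraph_iff[OF T(1), of "pverts T"] by simp
  have "\<exists>s t. (s, t) \<in> parcs T \<and> \<not> bridge (parcs T) s t" if p: "cycle p" "3 \<le> length p" for p
  proof -
    obtain u where u: "awalk u p u" "distinct (tl (pawalk_verts u p))"
      using p(1) unfolding cycle_def by blast
    obtain v q where pq: "p = (u, v) # q"
      using u(1) p(2) unfolding awalk_def by (cases p) auto
    have q: "pcas v q u" "set q \<subseteq> parcs T" "(u, v) \<in> parcs T" "distinct (pawalk_verts v q)" "2 \<le> length q"
      using u p(2) unfolding awalk_def pq by auto
    have "(u, v) \<notin> set q"
    proof
      assume "(u, v) \<in> set q"
      then have "v \<in> set (tl (pawalk_verts v q))"
        using arc_ends_in_pawalk_verts[OF q(1)] by blast
      moreover have "pawalk_verts v q = v # tl (pawalk_verts v q)"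
        using pawalk_verts_ends[OF q(1)] by (metis list.collapse pawalk_verts_not_Nil)
      ultimately show False using q(4) by (metis distinct.simps(2))
    qed
    \<comment> \<open>As \<open>v\<close> occurs only at the start of \<open>q\<close>, such an arc
      would come first; since \<open>q\<close> has at least two arcs, \<open>u\<close> would be
      visited after it and again at the end.\<close>
    moreover have "(v, u) \<notin> set q"
    proof
      assume vu: "(v, u) \<in> set q"
      obtain e r where e: "q = e # r" using q(5) by (cases q) auto
      have r: "pcas (snd e) r u" "fst e = v" "v \<notin> set (pawalk_verts (snd e) r)" "distinct (pawalk_verts (snd e) r)"
        using q e by auto
      have "(v, u) \<notin> set r"
        using arc_ends_in_pawalk_verts[OF r(1)] r(3) by blast
      then have "e = (v, u)" using vu e by auto
      obtain f r' where f: "r = f # r'" using q(5) e by (cases r) auto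
      have "u \<in> set (pawalk_verts (snd f) r')" "fst f = u"
        using pawalk_verts_ends[of "snd f" r' u] r(1) f \<open>e = (v, u)\<close>
          last_in_set[OF pawalk_verts_not_Nil[of "snd f" r']] by auto
      then show False using r(4) f by auto
    qed
    ultimately have "(v, u) \<in> (parcs T - {(u, v), (v, u)})\<^sup>*"
      using q(2) by (intro pcas_rtrancl[OF q(1)]) auto
    then show ?thesis using q(3) by (auto simp: bridge_def)
  qed
  moreover have "\<exists>p. cycle p \<and> 3 \<le> length p" if st: "(s, t) \<in> parcs T" "\<not> bridge (parcs T) s t" for s t
  proof -
    obtain p where p: "pcas t p s" "set p \<subseteq> parcs T - {(s, t), (t, s)}" "distinct (pawalk_verts t p)"
      using rtrancl_distinct_pawalk st(2) unfolding bridge_def by metis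
    have "s \<noteq> t" using st(1) T(3) by (auto simp: irrefl_def)
    then obtain e q where e: "p = e # q" using p(1) by (cases p) auto
    have "q \<noteq> []"
    proof
      assume "q = []"
      then have "e = (t, s)" using p(1) e by auto
      then show False using p(2) e by auto
    qed
    then have "3 \<le> length (p @ [(s, t)])" using e by (cases q) auto
    moreover have "pcas t (p @ [(s, t)]) t" using p(1) unfolding pcas_append by (intro exI[of _ s]) simp
    moreover have "distinct (tl (pawalk_verts t (p @ [(s, t)])))"
      unfolding pawalk_verts_append_single[OF p(1)] using p(1,3) e by auto
    moreover have "t \<in> pverts T" using st T(2) by auto
    moreover have "set (p @ [(s, t)]) \<subseteq> parcs T" using p(2) st(1) by auto
    ultimately have "cycle (p @ [(s, t)])"
      unfolding cycle_def awalk_def by blast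
    then show ?thesis using \<open>3 \<le> length (p @ [(s, t)])\<close> by blast
  qed
  ultimately show ?thesis
    unfolding undirected_tree_def conn using True by blast
qed (simp add: undirected_tree_def)

text \<open>Nodes are listed so that each new node \<open>t\<close> is joined by a tree edge to a
  node \<open>s\<close> of the connected set \<open>S\<close> listed so far; the bag of
  \<open>s\<close> then contains the overlap with all earlier bags.\<close>

lemma tree_decomposition_rip:
  assumes "tree_decomposition G T B"
  shows "rip (\<Union>(B ` pverts T)) (B ` pverts T)"
proof -
  have T: "pair_graph T" "pverts T \<noteq> {}" "connected_in (parcs T) (pverts T)"
    "\<And>s t. (s, t) \<in> parcs T \<Longrightarrow> bridge (parcs T) s t"
    using assms unfolding tree_decomposition_def undirected_tree_iff by auto
  have T': "finite (pverts T)" "sym (parcs T)" "parcs T \<subseteq> pverts T \<times> pverts T"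
    using T(1) unfolding pair_graph_iff by auto
  have nodes: "connected_in (parcs T) {t \<in> pverts T. x \<in> B t}" if "x \<in> pverts G" for x
    using assms that connected_induce_subgraph_iff[OF T'(2)] unfolding tree_decomposition_def by blast
  have bags: "B t \<subseteq> pverts G" if "t \<in> pverts T" for t
    using assms that unfolding tree_decomposition_def by blast
  have "\<exists>S \<subseteq> pverts T. card S = Suc n \<and> connected_in (parcs T) S \<and> rip (\<Union>(B ` S)) (B ` S)"
    if "n < card (pverts T)" for n
    using that
  proof (induction n)
    case 0
    obtain t where "t \<in> pverts T" using T(2) by blast
    then show ?case by (intro exI[of _ "{t}"]) (auto intro: rip.single)
  next
    case (Suc n)
    then obtain S where S: "S \<subseteq> pverts T" "card S = Suc n" "connected_in (parcs T) S" "rip (\<Union>(B ` S)) (B ` S)"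
      by auto
    obtain r where r: "r \<in> S" using S(2) by (cases "S = {}") auto
    have "S \<noteq> pverts T" using S(2) Suc.prems by auto
    then obtain r' where "r' \<in> pverts T" "r' \<notin> S" using S(1) by blast
    then obtain s t where st: "s \<in> S" "t \<in> pverts T" "t \<notin> S" "(s, t) \<in> parcs T"
      using connected_in_exit[OF T(3), of r r' S] r S(1) by blast
    let ?R = "(parcs T - {(s, t), (t, s)})\<^sup>*"
    have "B t \<inter> \<Union>(B ` S) \<subseteq> B s"
    proof
      fix x assume x: "x \<in> B t \<inter> \<Union>(B ` S)"
      then obtain s' where s': "s' \<in> S" "x \<in> B s'" by blast
      let ?N = "{t \<in> pverts T. x \<in> B t}"
      \<comment> \<open>Otherwise a route from \<open>t\<close> to \<open>s'\<close> through nodes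
        containing \<open>x\<close> misses \<open>s\<close>, and one from \<open>s'\<close> to
        \<open>s\<close> inside \<open>S\<close> misses \<open>t\<close>; together they bypass the
        bridge \<open>st\<close>.\<close>
      show "x \<in> B s"
      proof (rule ccontr)
        assume "x \<notin> B s"
        have "(t, s') \<in> (Restr (parcs T) ?N)\<^sup>*"
          using nodes[of x] bags st(2) x s' S(1) unfolding connected_in_def by blast
        then have "(t, s') \<in> ?R"
          using rtrancl_mono[of "Restr (parcs T) ?N" "parcs T - {(s, t), (t, s)}"] \<open>x \<notin> B s\<close> by auto
        moreover have "(s', s) \<in> (Restr (parcs T) S)\<^sup>*"
          using S(3) s' st(1) unfolding connected_in_def by blast
        then have "(s', s) \<in> ?R"
          using rtrancl_mono[of "Restr (parcs T) S" "parcs T - {(s, t), (t, s)}"] st(3) by auto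
        ultimately have "(t, s) \<in> ?R" by (rule rtrancl_trans)
        then show False using T(4)[OF st(4)] by (simp add: bridge_def)
      qed
    qed
    then have "rip (\<Union>(B ` S) \<union> B t) (insert (B t) (B ` S))"
      using S(4) st(1) by (intro rip.add[of _ _ "B s"]) auto
    moreover have "connected_in (parcs T) (S \<union> {t})"
      using st by (intro connected_in_Un[OF T'(2) S(3)]) auto
    moreover have "card (insert t S) = Suc (Suc n)"
      using S st T'(1) finite_subset by fastforce
    ultimately show ?case
      using S(1) st(2) by (intro exI[of _ "insert t S"]) (auto simp: Un_commute)
  qed
  moreover have "0 < card (pverts T)" using T(2) T'(1) by (simp add: card_gt_0_iff)
  ultimately obtain S where S: "S \<subseteq> pverts T" "card S = card (pverts T)" "rip (\<Union>(B ` S)) (B ` S)"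
    by (metis Suc_pred' diff_less zero_less_one)
  then have "S = pverts T" using card_subset_eq T'(1) by blast
  then show ?thesis using S by simp
qed

text \<open>Each added bag becomes a new leaf \<open>n\<close> hanging on a node \<open>s\<close>
  that carries the bag \<open>X\<close>.\<close>

lemma rip_tree:
  assumes "rip V \<B>"
  shows "\<exists>(T :: nat pair_pre_digraph) B. undirected_tree T \<and> B ` pverts T = \<B> \<and>
    (\<forall>x\<in>V. connected_in (parcs T) {t \<in> pverts T. x \<in> B t})"
  using assms
proof (induction rule: rip.induct)
  case (single X)
  let ?T = "\<lparr>pverts = {0 :: nat}, parcs = {}\<rparr>"
  have "undirected_tree ?T"
    unfolding undirected_tree_iff pair_graph_iff by (auto simp: sym_def irrefl_def)
  then show ?case
    by (intro exI[of _ ?T] exI[of _ "\<lambda>_. X"]) auto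
next
  case (add V \<B> X Y)
  then obtain T :: "nat pair_pre_digraph" and B where TB: "undirected_tree T" "B ` pverts T = \<B>"
    "\<And>x. x \<in> V \<Longrightarrow> connected_in (parcs T) {t \<in> pverts T. x \<in> B t}" by blast
  have T: "pair_graph T" "pverts T \<noteq> {}" "connected_in (parcs T) (pverts T)"
    "\<And>s t. (s, t) \<in> parcs T \<Longrightarrow> bridge (parcs T) s t"
    using TB(1) unfolding undirected_tree_iff by auto
  have T': "finite (pverts T)" "sym (parcs T)" "parcs T \<subseteq> pverts T \<times> pverts T" "irrefl (parcs T)"
    using T(1) unfolding pair_graph_iff by auto
  obtain s where s: "s \<in> pverts T" "B s = X" using TB(2) add.hyps by blast
  obtain n where n: "n \<notin> pverts T" using T'(1) ex_new_if_finite infinite_UNIV_nat by blast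
  let ?E = "parcs T \<union> {(s, n), (n, s)}"
  let ?T = "\<lparr>pverts = insert n (pverts T), parcs = ?E\<rparr>"
  let ?B = "B(n := Y)"
  have E: "sym ?E" using T'(2) by (auto simp: sym_def)
  have "s \<noteq> n" using s n by blast
  have "pair_graph ?T"
    unfolding pair_graph_iff using T' E s \<open>s \<noteq> n\<close> by (auto simp: irrefl_def)
  moreover have conn_T: "connected_in ?E S" if "connected_in (parcs T) S" for S
    using that by (rule connected_in_mono) auto
  have "connected_in ?E (pverts T \<union> {n})"
    using s by (intro connected_in_Un[OF E conn_T[OF T(3)], of _ s n]) auto
  then have "connected_in ?E (insert n (pverts T))" by simp
  moreover have "bridge ?E u v" if "(u, v) \<in> ?E" for u v
  proof (cases "(u, v) \<in> parcs T")
    case True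
    \<comment> \<open>Retracting the new leaf to \<open>s\<close> turns a walk in the larger graph
      into one in \<open>T\<close>, so old edges remain bridges.\<close>
    let ?h = "\<lambda>x. if x = n then s else x"
    have uv: "u \<noteq> n" "v \<noteq> n" using True T'(3) n by auto
    have "(?h x, ?h y) \<in> (parcs T - {(u, v), (v, u)})\<^sup>*" if "(x, y) \<in> (?E - {(u, v), (v, u)})\<^sup>*" for x y
      using that
    proof (induction rule: rtrancl_induct)
      case (step y z)
      show ?case
      proof (cases "y = n \<or> z = n")
        case True
        then have "?h y = ?h z" using step.hyps T'(3) n by auto
        then show ?thesis using step.IH by simp
      next
        case False
        then have "(?h y, ?h z) \<in> parcs T - {(u, v), (v, u)}" using step.hyps by auto
        with step.IH show ?thesis by (rule rtrancl.rtrancl_into_rtrancl)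
      qed
    qed simp
    from this[of v u] show ?thesis
      using T(4)[OF True] uv unfolding bridge_def by auto
  next
    case False
    have none: "\<not> (n, z) \<in> ?E - {(u, v), (v, u)}" "\<not> (z, n) \<in> ?E - {(u, v), (v, u)}" for z
      using that False T'(3) n by auto
    show ?thesis
      unfolding bridge_def
    proof
      assume "(v, u) \<in> (?E - {(u, v), (v, u)})\<^sup>*"
      moreover have "v \<noteq> u" "v = n \<or> u = n" using that False \<open>s \<noteq> n\<close> by auto
      ultimately show False
        using none by (metis converse_rtranclE rtranclE)
    qed
  qed
  ultimately have "undirected_tree ?T"
    unfolding undirected_tree_iff by simp
  moreover have "?B ` pverts ?T = insert Y \<B>"
    using TB(2) n by auto
  moreover have "connected_in ?E {t \<in> pverts ?T. x \<in> ?B t}" if x: "x \<in> V \<union> Y" for x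
  proof -
    let ?N = "{t \<in> pverts T. x \<in> B t}"
    have N: "{t \<in> pverts ?T. x \<in> ?B t} = (if x \<in> Y then ?N \<union> {n} else ?N)"
      using n by auto
    show ?thesis
    proof (cases "x \<in> V")
      case True
      have "connected_in ?E (?N \<union> {n})" if "x \<in> Y"
        using that add.hyps True s
        by (intro connected_in_Un[OF E conn_T[OF TB(3)[OF True]], of _ s n]) auto
      then show ?thesis unfolding N using conn_T[OF TB(3)[OF True]] by auto
    next
      case False
      then have "?N = {}" "x \<in> Y" using x TB(2) rip_Union[OF add.hyps(1)] by auto
      then have "{t \<in> pverts ?T. x \<in> ?B t} = {n}" unfolding N by auto
      then show ?thesis by simp
    qed
  qed
  ultimately show ?case
    by (intro exI[of _ ?T] exI[of _ ?B]) simp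
qed

text \<open>\<open>P\<close> may be any property of the family of bags, so that one equivalence
  serves both treewidth and \<open>mtw\<close>.\<close>

theorem tree_decomposition_iff_rip:
  assumes G: "pair_graph G"
  shows "(\<exists>T B. tree_decomposition G T B \<and> P (B ` pverts T)) \<longleftrightarrow>
    (\<exists>\<B>. rip (pverts G) \<B> \<and> parcs G \<subseteq> cohabit \<B> \<and> P \<B>)"
proof
  assume "\<exists>T B. tree_decomposition G T B \<and> P (B ` pverts T)"
  then obtain T B where TB: "tree_decomposition G T B" "P (B ` pverts T)" by blast
  then have T: "sym (parcs T)"
    unfolding tree_decomposition_def undirected_tree_iff pair_graph_iff by blast
  have "\<Union>(B ` pverts T) = pverts G"
  proof
    show "\<Union>(B ` pverts T) \<subseteq> pverts G"
      using TB(1) unfolding tree_decomposition_def by blast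
    have "{t \<in> pverts T. v \<in> B t} \<noteq> {}" if "v \<in> pverts G" for v
      using TB(1) that unfolding tree_decomposition_def connected_induce_subgraph_iff[OF T] by blast
    then show "pverts G \<subseteq> \<Union>(B ` pverts T)" by blast
  qed
  then have "rip (pverts G) (B ` pverts T)"
    using tree_decomposition_rip[OF TB(1)] by simp
  moreover have "parcs G \<subseteq> cohabit (B ` pverts T)"
    using TB(1) unfolding tree_decomposition_def cohabit_def by auto
  ultimately show "\<exists>\<B>. rip (pverts G) \<B> \<and> parcs G \<subseteq> cohabit \<B> \<and> P \<B>"
    using TB(2) by blast
next
  assume "\<exists>\<B>. rip (pverts G) \<B> \<and> parcs G \<subseteq> cohabit \<B> \<and> P \<B>"
  then obtain \<B> where B: "rip (pverts G) \<B>" "parcs G \<subseteq> cohabit \<B>" "P \<B>" by blast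
  obtain T :: "nat pair_pre_digraph" and B where TB: "undirected_tree T" "B ` pverts T = \<B>"
    "\<forall>x\<in>pverts G. connected_in (parcs T) {t \<in> pverts T. x \<in> B t}"
    using rip_tree[OF B(1)] by blast
  have T: "sym (parcs T)"
    using TB(1) unfolding undirected_tree_iff pair_graph_iff by blast
  have "tree_decomposition G T B"
    unfolding tree_decomposition_def connected_induce_subgraph_iff[OF T]
  proof (intro conjI TB(1) ballI)
    show "B t \<subseteq> pverts G" if "t \<in> pverts T" for t
      using that rip_Union[OF B(1)] TB(2) by auto
    show "case e of (u, v) \<Rightarrow> \<exists>t\<in>pverts T. u \<in> B t \<and> v \<in> B t" if "e \<in> parcs G" for e
      using that B(2) unfolding cohabit_def TB(2)[symmetric] by auto
    show "{t \<in> pverts T. v \<in> B t} \<noteq> {}" if "v \<in> pverts G" for v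
      using that rip_Union[OF B(1)] TB(2) by auto
    show "connected_in (parcs T) {t \<in> pverts T. v \<in> B t}" if "v \<in> pverts G" for v
      using that TB(3) by blast
  qed
  then show "\<exists>T B. tree_decomposition G T B \<and> P (B ` pverts T)"
    using B(3) TB(2) by blast
qed

section \<open>Decompositions into bags of a given kind\<close>

text \<open>Keeping \<open>E\<close> fixed and letting only \<open>W\<close> vary treats induced
  subgraphs without constructing new graphs.\<close>

definition decomp :: "('a \<times> 'a) set \<Rightarrow> ('a set \<Rightarrow> bool) \<Rightarrow> 'a set \<Rightarrow> 'a set set \<Rightarrow> bool" where
  "decomp E P W \<B> \<longleftrightarrow> rip W \<B> \<and> Restr E W \<subseteq> cohabit \<B> \<and> (\<forall>B\<in>\<B>. P B)"

lemma decompD: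
  assumes "decomp E P W \<B>"
  shows "rip W \<B>" "Restr E W \<subseteq> cohabit \<B>" "B \<in> \<B> \<Longrightarrow> P B"
  using assms by (auto simp: decomp_def)

lemma decomp_single: "P B \<Longrightarrow> decomp E P B {B}"
  by (auto simp: decomp_def cohabit_def intro: rip.single)

text \<open>The overlap lies in one bag on either side and separates the two parts, so joining these
  two bags by a tree edge is enough.\<close>

lemma decomp_glue:
  assumes "sym E" "decomp E P V \<B>" "decomp E P V' \<B>'" "X \<in> \<B>" "X' \<in> \<B>'" "V \<inter> V' \<subseteq> X \<inter> X'"
    and no_cross: "\<And>x y. x \<in> V - V' \<Longrightarrow> y \<in> V' - V \<Longrightarrow> (x, y) \<notin> E"
  shows "decomp E P (V \<union> V') (\<B> \<union> \<B>')"
proof -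
  have "Restr E (V \<union> V') \<subseteq> Restr E V \<union> Restr E V'"
    using no_cross symD[OF assms(1)] by blast
  then have "Restr E (V \<union> V') \<subseteq> cohabit \<B> \<union> cohabit \<B>'"
    using decompD(2)[OF assms(2)] decompD(2)[OF assms(3)] by blast
  then have "Restr E (V \<union> V') \<subseteq> cohabit (\<B> \<union> \<B>')"
    unfolding cohabit_def by blast
  then show ?thesis
    using rip_glue[OF decompD(1)[OF assms(2)] decompD(1)[OF assms(3)] assms(4-6)]
      decompD(3)[OF assms(2)] decompD(3)[OF assms(3)]
    by (auto simp: decomp_def)
qed

lemma decomp_vertex_bag:
  assumes "decomp E P W \<B>" "x \<in> W"
  shows "\<exists>B\<in>\<B>. x \<in> B"
  using rip_Union[OF decompD(1)[OF assms(1)]] assms(2) by blast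

lemma decomp_edge_bag:
  assumes "decomp E P W \<B>" "(x, y) \<in> E" "x \<in> W" "y \<in> W"
  shows "\<exists>B\<in>\<B>. x \<in> B \<and> y \<in> B"
  using decompD(2)[OF assms(1)] assms(2-4) unfolding cohabit_def by blast

text \<open>Meant for \<open>small\<close>. Connectivity of bags need not survive the intersection,
  so good decompositions of subsets have to come from the induction.\<close>

lemma decomp_restrict:
  assumes "decomp E P V \<B>" "W \<subseteq> V" "\<And>B. P B \<Longrightarrow> P (B \<inter> W)"
  shows "\<exists>\<B>'. decomp E P W \<B>'"
proof -
  let ?B = "(\<lambda>B. B \<inter> W) ` \<B>"
  have "rip W ?B"
    using rip_restrict[OF decompD(1)[OF assms(1)], of W] assms(2) by (simp add: Int_absorb1)
  moreover have "Restr E W \<subseteq> cohabit ?B"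
  proof (rule subrelI)
    fix x y assume xy: "(x, y) \<in> Restr E W"
    then obtain B where "B \<in> \<B>" "x \<in> B" "y \<in> B"
      using decomp_edge_bag[OF assms(1), of x y] assms(2) by blast
    then show "(x, y) \<in> cohabit ?B"
      using xy unfolding cohabit_def by auto
  qed
  ultimately show ?thesis
    using assms(3) decompD(3)[OF assms(1)] unfolding decomp_def by blast
qed

section \<open>Brambles in decompositions\<close>

definition touches :: "('a \<times> 'a) set \<Rightarrow> 'a set \<Rightarrow> 'a set \<Rightarrow> bool" where
  "touches E S T \<longleftrightarrow> (\<exists>x\<in>S. \<exists>y\<in>T. x = y \<or> (x, y) \<in> E)"

lemma touches_Un [simp]:
  "touches E (S \<union> S') T \<longleftrightarrow> touches E S T \<or> touches E S' T"
  "touches E S (T \<union> T') \<longleftrightarrow> touches E S T \<or> touches E S T'"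
  by (auto simp: touches_def)

lemma touches_sym: "sym E \<Longrightarrow> touches E S T \<Longrightarrow> touches E T S"
  unfolding touches_def by (metis symD)

lemma decomp_bramble:
  assumes D: "decomp E P W \<B>"
    and S: "\<And>S. S \<in> \<S> \<Longrightarrow> S \<noteq> {} \<and> S \<subseteq> W \<and> connected_in E S"
    and touch: "\<And>S T. S \<in> \<S> \<Longrightarrow> T \<in> \<S> \<Longrightarrow> touches E S T"
  shows "\<exists>B\<in>\<B>. \<forall>S\<in>\<S>. S \<inter> B \<noteq> {}"
proof (rule rip_bramble[OF decompD(1)[OF D]])
  fix S assume "S \<in> \<S>"
  note S = S[OF this]
  then have "Restr E S \<subseteq> cohabit \<B>"
    using decompD(2)[OF D] by blast
  then show "S \<noteq> {} \<and> S \<subseteq> W \<and> connected_in (cohabit \<B>) S"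
    using S connected_in_mono by blast
next
  fix S T assume ST: "S \<in> \<S>" "T \<in> \<S>"
  then obtain x y where xy: "x \<in> S" "y \<in> T" "x = y \<or> (x, y) \<in> E"
    using touch unfolding touches_def by blast
  then have "x \<in> W" "y \<in> W" using S ST by blast+
  then have "(x, y) \<in> cohabit \<B>"
    using xy(3) decomp_vertex_bag[OF D] decomp_edge_bag[OF D] unfolding cohabit_def by blast
  then show "\<exists>x\<in>S. \<exists>y\<in>T. (x, y) \<in> cohabit \<B>"
    using xy by blast
qed

section \<open>Bags with at most three vertices\<close>

text \<open>Three vertices correspond to width 2; finiteness is stated since infinite sets have
  \<open>card\<close> zero.\<close>

definition small :: "'a set \<Rightarrow> bool" where
  "small B \<longleftrightarrow> finite B \<and> card B \<le> 3"

text \<open>Describes the matched bags of at most three vertices; excluding cardinality 1 leaves the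
  empty bag, which the empty matching covers.\<close>

definition good :: "('a \<times> 'a) set \<Rightarrow> 'a set \<Rightarrow> bool" where
  "good E B \<longleftrightarrow> small B \<and> connected_in E B \<and> card B \<noteq> 1"

lemma good_empty: "good E {}"
  by (simp add: good_def small_def)

lemma good_edge:
  assumes "sym E" "irrefl E" "(x, y) \<in> E"
  shows "good E {x, y}"
proof -
  have "x \<noteq> y" using assms by (auto simp: irrefl_def)
  then show ?thesis
    using connected_in_edge[OF assms(1,3)] by (simp add: good_def small_def)
qed

lemma good_path3:
  assumes "sym E" "irrefl E" "(x, y) \<in> E" "(x, z) \<in> E" "y \<noteq> z"
  shows "good E {x, y, z}"
proof -
  have "x \<noteq> y" "x \<noteq> z" using assms by (auto simp: irrefl_def)
  then show ?thesis
    using connected_in_path3[OF assms(1,3,4)] assms(5) by (simp add: good_def small_def)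
qed

text \<open>Three vertices have room for at most one matching edge, so a nonempty bag is that edge,
  possibly with a third vertex attached to one of its ends.\<close>

lemma matched_bag_imp_good:
  assumes G: "pair_graph G" and X: "small X" and M: "matched_bag G X"
  shows "good (parcs G) X"
proof -
  have E: "sym (parcs G)" "irrefl (parcs G)"
    using G unfolding pair_graph_iff by auto
  have X': "finite X" "card X \<le> 3" using X by (auto simp: small_def)
  obtain M where M: "matching (with_proj G \<restriction> X) M" and
    cov: "\<Union>M = X \<or> (\<exists>v \<in> X. \<Union>M = X - {v} \<and> (\<exists>w \<in> \<Union>M. (v, w) \<in> parcs G))"
    using M unfolding matched_bag_def with_proj_simps by (elim exE conjE) (rule that)
  have edge: "\<exists>u v. e = {u, v} \<and> (u, v) \<in> parcs G \<and> u \<in> X \<and> v \<in> X \<and> u \<noteq> v" if "e \<in> M" for e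
  proof -
    have "e \<in> {{u, v} |u v. (u, v) \<in> arcs_ends (with_proj G \<restriction> X)}"
      using M that unfolding matching_def by blast
    then obtain u v where "e = {u, v}" "(u, v) \<in> arcs_ends (with_proj G \<restriction> X)" by blast
    then show ?thesis
      using E(2) by (intro exI[of _ u] exI[of _ v]) (auto simp: arcs_ends_conv irrefl_def)
  qed
  show ?thesis
  proof (cases "M = {}")
    case True
    then have "X = {}" using cov by auto
    then show ?thesis by (simp add: good_empty)
  next
    case False
    then obtain e where e: "e \<in> M" by blast
    then obtain u v where uv: "e = {u, v}" "(u, v) \<in> parcs G" "u \<in> X" "v \<in> X" "u \<noteq> v"
      using edge by blast
    have "f = e" if f: "f \<in> M" for f
    proof (rule ccontr)
      assume "f \<noteq> e"
      then have "f \<inter> e = {}" using M e f unfolding matching_def by blast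
      moreover obtain u' v' where "f = {u', v'}" "u' \<in> X" "v' \<in> X" "u' \<noteq> v'"
        using edge f by blast
      ultimately have "card {u, v, u', v'} = 4" "{u, v, u', v'} \<subseteq> X"
        using uv by auto
      then show False using X' card_mono[of X "{u, v, u', v'}"] by simp
    qed
    then have "M = {e}" using e by blast
    then have UM: "\<Union>M = {u, v}" using uv(1) by simp
    from cov show ?thesis
    proof
      assume "\<Union>M = X"
      then show ?thesis using UM good_edge[OF E uv(2)] by simp
    next
      assume "\<exists>x \<in> X. \<Union>M = X - {x} \<and> (\<exists>w \<in> \<Union>M. (x, w) \<in> parcs G)"
      then obtain x w where x: "x \<in> X" "{u, v} = X - {x}" "w \<in> {u, v}" "(x, w) \<in> parcs G"
        unfolding UM by blast
      have vu: "(v, u) \<in> parcs G" and wx: "(w, x) \<in> parcs G"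
        using uv(2) x(4) E(1) by (auto dest: symD)
      have "X = {u, v, x}" "X = {v, u, x}" "x \<noteq> u" "x \<noteq> v" using x by auto
      then show ?thesis
        using good_path3[OF E uv(2), of x] good_path3[OF E vu, of x] wx x(3) by auto
    qed
  qed
qed

lemma good_imp_matched_bag:
  assumes G: "pair_graph G" and X: "good (parcs G) X"
  shows "matched_bag G X"
proof -
  have E: "sym (parcs G)"
    using G unfolding pair_graph_iff by auto
  have X': "finite X" "card X \<le> 3" "card X \<noteq> 1" "connected_in (parcs G) X"
    using X by (auto simp: good_def small_def)
  show ?thesis
  proof (cases "X = {}")
    case True
    then show ?thesis
      unfolding matched_bag_def by (intro exI[of _ "{}"]) (auto simp: matching_def)
  next
    case False
    then obtain x where x: "x \<in> X" by blast
    have "X \<noteq> {x}" using X'(3) by auto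
    then obtain y where "y \<in> X" "y \<noteq> x" using x by blast
    then obtain q where q: "q \<in> X" "q \<noteq> x" "(x, q) \<in> parcs G"
      using connected_in_exit[OF X'(4) x, of y "{x}"] by auto
    have M: "matching (with_proj G \<restriction> X) {{x, q}}"
      using q x by (auto simp: matching_def arcs_ends_conv)
    show ?thesis
    proof (cases "X = {x, q}")
      case True
      then show ?thesis using M unfolding matched_bag_def by (intro exI[of _ "{{x, q}}"]) simp
    next
      case False
      then obtain r where r: "r \<in> X" "r \<noteq> x" "r \<noteq> q" using x q by blast
      have "{x, q, r} = X"
        using X' x q r by (intro card_seteq) auto
      then obtain p where "p \<in> {x, q}" "(p, r) \<in> parcs G"
        using connected_in_exit[OF X'(4) x r(1), of "{x, q}"] r by auto
      then have "\<exists>w \<in> \<Union>{{x, q}}. (r, w) \<in> parcs G" using E by (auto dest: symD)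
      moreover have "\<Union>{{x, q}} = X - {r}" using \<open>{x, q, r} = X\<close> r by auto
      ultimately show ?thesis
        using M r(1) unfolding matched_bag_def with_proj_simps by blast
    qed
  qed
qed

section \<open>Width at most two as existence of a family of bags\<close>

lemma INF_width_le_2_iff:
  "(INF (T, B) \<in> A. enat (width T B)) \<le> 2 \<longleftrightarrow> (\<exists>T B. (T, B) \<in> A \<and> width T B \<le> 2)"
proof
  assume "(INF (T, B) \<in> A. enat (width T B)) \<le> 2"
  \<comment> \<open>The strict bound 3 yields a member below it without showing that the infimum is
    attained; a width below 3 is at most 2.\<close>
  also have "2 < (3 :: enat)" by simp
  finally obtain T B where "(T, B) \<in> A" "enat (width T B) < 3"
    unfolding INF_less_iff by auto
  then show "\<exists>T B. (T, B) \<in> A \<and> width T B \<le> 2"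
    by (intro exI[of _ T] exI[of _ B]) (simp add: numeral_eq_enat)
next
  assume "\<exists>T B. (T, B) \<in> A \<and> width T B \<le> 2"
  then obtain T B where TB: "(T, B) \<in> A" "width T B \<le> 2" by blast
  then have "(INF (T, B) \<in> A. enat (width T B)) \<le> enat (width T B)"
    by (intro INF_lower2[of "(T, B)"]) auto
  also have "\<dots> \<le> 2" using TB(2) by (simp add: numeral_eq_enat)
  finally show "(INF (T, B) \<in> A. enat (width T B)) \<le> 2" .
qed

lemma width_le_2_iff_small:
  assumes G: "pair_graph G" and D: "tree_decomposition G T B"
  shows "width T B \<le> 2 \<longleftrightarrow> (\<forall>X \<in> B ` pverts T. small X)"
proof -
  have T: "finite (pverts T)" "pverts T \<noteq> {}"
    using D unfolding tree_decomposition_def undirected_tree_iff pair_graph_iff by auto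
  have "finite (B t)" if "t \<in> pverts T" for t
    using D G that unfolding tree_decomposition_def pair_graph_iff by (meson finite_subset)
  moreover have "width T B \<le> 2 \<longleftrightarrow> (\<forall>t \<in> pverts T. card (B t) \<le> 3)"
    using T by (simp add: width_def le_diff_conv)
  ultimately show ?thesis
    unfolding small_def by blast
qed

theorem treewidth_le_2_iff:
  assumes G: "pair_graph G"
  shows "treewidth G \<le> 2 \<longleftrightarrow> (\<exists>\<B>. decomp (parcs G) small (pverts G) \<B>)"
proof -
  have "Restr (parcs G) (pverts G) = parcs G"
    using G unfolding pair_graph_iff by auto
  moreover have "treewidth G \<le> 2 \<longleftrightarrow> (\<exists>T B. tree_decomposition G T B \<and> (\<forall>X \<in> B ` pverts T. small X))"
    unfolding treewidth_def INF_width_le_2_iff using width_le_2_iff_small[OF G] by blast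
  ultimately show ?thesis
    using tree_decomposition_iff_rip[OF G, of "\<lambda>\<B>. \<forall>X\<in>\<B>. small X"] by (simp add: decomp_def)
qed

theorem mtw_le_2_iff:
  assumes G: "pair_graph G"
  shows "mtw G \<le> 2 \<longleftrightarrow> (\<exists>\<B>. decomp (parcs G) (good (parcs G)) (pverts G) \<B>)"
proof -
  have "Restr (parcs G) (pverts G) = parcs G"
    using G unfolding pair_graph_iff by auto
  moreover have "small X \<and> matched_bag G X \<longleftrightarrow> good (parcs G) X" for X
    using matched_bag_imp_good[OF G, of X] good_imp_matched_bag[OF G, of X] by (auto simp: good_def)
  then have "(matched_tree_decomposition G T B \<and> width T B \<le> 2) \<longleftrightarrow>
      (tree_decomposition G T B \<and> (\<forall>X \<in> B ` pverts T. good (parcs G) X))" for T B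
    using width_le_2_iff_small[OF G, of T B] unfolding matched_tree_decomposition_def by blast
  then have "mtw G \<le> 2 \<longleftrightarrow> (\<exists>T B. tree_decomposition G T B \<and> (\<forall>X \<in> B ` pverts T. good (parcs G) X))"
    unfolding mtw_def INF_width_le_2_iff by simp
  ultimately show ?thesis
    using tree_decomposition_iff_rip[OF G, of "\<lambda>\<B>. \<forall>X\<in>\<B>. good (parcs G) X"]
    by (simp add: decomp_def)
qed

section \<open>Connected bags exclude the five-cycle\<close>

lemma C5_verts: "pverts C5 = {0, 1, 2, 3, 4}"
  by (auto simp: cycle_graph_def)

lemma C5_arcs:
  "parcs C5 = {(0, 1), (1, 0), (1, 2), (2, 1), (2, 3), (3, 2), (3, 4), (4, 3), (4, 0), (0, 4)}"
proof -
  have "(i < 5 \<and> j < 5 \<and> (j = (i + 1) mod 5 \<or> i = (j + 1) mod 5)) \<longleftrightarrow>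
      (i = 0 \<and> j = 1 \<or> i = 1 \<and> j = 0 \<or> i = 1 \<and> j = 2 \<or> i = 2 \<and> j = 1 \<or> i = 2 \<and> j = 3 \<or>
       i = 3 \<and> j = 2 \<or> i = 3 \<and> j = 4 \<or> i = 4 \<and> j = 3 \<or> i = 4 \<and> j = 0 \<or> i = 0 \<and> j = 4)"
    for i j :: nat
  proof (cases "i < 5")
    case True
    then consider "i = 0" | "i = 1" | "i = 2" | "i = 3" | "i = 4" by linarith
    then show ?thesis by cases (simp, presburger)+
  qed auto
  then show ?thesis
    unfolding cycle_graph_def by (simp add: set_eq_iff)
qed

lemma pair_graph_C5: "pair_graph C5"
  unfolding pair_graph_iff C5_verts C5_arcs by (auto simp: sym_def irrefl_def)

lemma good_decomp_no_C5:
  assumes E: "sym E" and D: "decomp E (good E) W \<B>" and U: "U \<subseteq> W" and f: "minor_map E U C5 f"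
  shows False
proof -
  define F where "F i = {x \<in> U. f x = i}" for i
  have conn: "connected_in E (F i)" for i
    using minor_mapD(2)[OF f] by (simp add: F_def)
  have arc: "touches E (F i) (F j) \<and> connected_in E (F i \<union> F j)" if ij: "(i, j) \<in> parcs C5" for i j
  proof -
    obtain x y where "x \<in> F i" "y \<in> F j" "(x, y) \<in> E"
      using minor_mapD(4)[OF f ij] unfolding F_def by blast
    then show ?thesis
      using connected_in_Un[OF E conn conn] unfolding touches_def by blast
  qed
  have ne: "F i \<noteq> {}" if "i \<in> pverts C5" for i
  proof -
    have "i \<in> f ` U" using minor_mapD(1)[OF f] that by simp
    then show ?thesis unfolding F_def by auto
  qed
  have refl: "touches E (F i) (F i)" if "i \<in> pverts C5" for i
    using ne[OF that] unfolding touches_def by blast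
  have t: "touches E (F 0) (F 1)" "touches E (F 1) (F 2)" "touches E (F 2) (F 3)" "touches E (F 3) (F 4)"
    "touches E (F 4) (F 0)" "touches E (F 1) (F 0)" "touches E (F 2) (F 1)" "touches E (F 3) (F 2)"
    "touches E (F 4) (F 3)" "touches E (F 0) (F 4)"
    using arc by (simp_all add: C5_arcs)
  have r: "touches E (F 0) (F 0)" "touches E (F 1) (F 1)" "touches E (F 2) (F 2)"
    "touches E (F 3) (F 3)" "touches E (F 4) (F 4)"
    using refl by (simp_all add: C5_verts)
  \<comment> \<open>Any two of these sets share a branch set or contain adjacent ones, so they form
    a bramble.\<close>
  let ?S = "{F 0 \<union> F 1, F 1 \<union> F 2, F 2 \<union> F 3, F 3 \<union> F 4, F 4 \<union> F 0}"
  have "\<exists>B\<in>\<B>. \<forall>S\<in>?S. S \<inter> B \<noteq> {}"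
  proof (rule decomp_bramble[OF D])
    fix S assume "S \<in> ?S"
    moreover have "F i \<subseteq> W" for i using U unfolding F_def by blast
    ultimately show "S \<noteq> {} \<and> S \<subseteq> W \<and> connected_in E S"
      using arc[unfolded C5_arcs] ne[unfolded C5_verts] by auto
  next
    fix S T assume "S \<in> ?S" "T \<in> ?S"
    then show "touches E S T"
      by (elim insertE emptyE) (simp_all only: touches_Un t r simp_thms)
  qed
  then obtain B where B: "B \<in> \<B>" "\<forall>S\<in>?S. S \<inter> B \<noteq> {}" by blast
  have good: "finite B" "card B \<le> 3" "connected_in E B"
    using decompD(3)[OF D B(1)] by (auto simp: good_def small_def)
  \<comment> \<open>Having at most three vertices, such a bag is \<open>{x, y, z}\<close>; its
    connectivity demands an edge at \<open>x\<close>, which would force an arc of \<open>C5\<close>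
    from \<open>i\<close> to \<open>j\<close> or \<open>k\<close>.\<close>
  have triple: "\<not> (F i \<inter> B \<noteq> {} \<and> F j \<inter> B \<noteq> {} \<and> F k \<inter> B \<noteq> {})"
    if "i \<noteq> j" "i \<noteq> k" "j \<noteq> k" "(i, j) \<notin> parcs C5" "(i, k) \<notin> parcs C5" for i j k
  proof
    assume "F i \<inter> B \<noteq> {} \<and> F j \<inter> B \<noteq> {} \<and> F k \<inter> B \<noteq> {}"
    then obtain x y z where xyz: "x \<in> F i" "y \<in> F j" "z \<in> F k" "x \<in> B" "y \<in> B" "z \<in> B" by blast
    then have f_xyz: "f x = i" "f y = j" "f z = k" "x \<in> U" "y \<in> U" "z \<in> U"
      unfolding F_def by auto
    have ne: "x \<noteq> y" "x \<noteq> z" "y \<noteq> z" using f_xyz that by blast+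
    then have "{x, y, z} = B"
      using good xyz by (intro card_seteq) auto
    then obtain q where "q \<in> {y, z}" "(x, q) \<in> E"
      using connected_in_exit[OF good(3) xyz(4,5), of "{x}"] ne(1) by auto
    then show False
      using minor_mapD(3)[OF f, of x q] f_xyz that by auto
  qed
  \<comment> \<open>The indices hit by the bag form a vertex cover of the cycle, so they include
    \<open>c\<close>, \<open>c + 2\<close> and \<open>c + 3\<close> modulo 5 for some
    \<open>c\<close>, and \<open>c\<close> is adjacent to neither of the others.\<close>
  define h where "h i \<longleftrightarrow> F i \<inter> B \<noteq> {}" for i
  have "h 0 \<or> h 1" "h 1 \<or> h 2" "h 2 \<or> h 3" "h 3 \<or> h 4" "h 4 \<or> h 0"
    using B(2) unfolding h_def by (simp_all add: Int_Un_distrib2)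
  moreover have "\<not> (h 0 \<and> h 2 \<and> h 3)" "\<not> (h 1 \<and> h 3 \<and> h 4)" "\<not> (h 2 \<and> h 4 \<and> h 0)"
    "\<not> (h 3 \<and> h 0 \<and> h 1)" "\<not> (h 4 \<and> h 1 \<and> h 2)"
    unfolding h_def by (rule triple; simp add: C5_arcs)+
  ultimately show False by blast
qed

section \<open>Constructing a decomposition into connected bags\<close>

text \<open>Neighbours are required within \<open>W\<close> itself. This is not inherited by
  subsets, so every piece handed to the induction has to be checked for it.\<close>

definition no_isolated :: "('a \<times> 'a) set \<Rightarrow> 'a set \<Rightarrow> bool" where
  "no_isolated E W \<longleftrightarrow> (\<forall>x\<in>W. \<exists>y\<in>W. (x, y) \<in> E)"

lemma no_isolatedE:
  assumes "no_isolated E W" "x \<in> W"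
  obtains y where "y \<in> W" "(x, y) \<in> E"
  using assms unfolding no_isolated_def by blast

definition C5_free :: "('a \<times> 'a) set \<Rightarrow> 'a set \<Rightarrow> bool" where
  "C5_free E W \<longleftrightarrow> (\<nexists>U f. U \<subseteq> W \<and> minor_map E U C5 f)"

text \<open>\<open>D\<close> hangs on the rest at \<open>e\<close> alone. If \<open>e\<close> has a
  neighbour in \<open>D\<close>, then \<open>insert e D\<close> has no isolated vertices and is
  glued on at \<open>e\<close>; otherwise \<open>D\<close> has none, nothing joins it to the rest,
  and the families can be joined at arbitrary bags.\<close>

lemma decomp_cut_vertex:
  assumes E: "sym E"
    and IH: "\<And>W'. W' \<subset> W \<Longrightarrow> no_isolated E W' \<Longrightarrow> \<exists>\<B>. decomp E P W' \<B>"
    and W: "no_isolated E W" and D: "D \<subseteq> W" "D \<noteq> {}" and e: "e \<in> W - D" "insert e D \<noteq> W"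
    and closed: "\<And>x y. x \<in> D \<Longrightarrow> y \<in> W \<Longrightarrow> (x, y) \<in> E \<Longrightarrow> y \<in> insert e D"
    and W': "no_isolated E (W - D)"
  shows "\<exists>\<B>. decomp E P W \<B>"
proof -
  have "W - D \<subset> W" using D by blast
  then obtain \<B> where B: "decomp E P (W - D) \<B>" using IH W' by blast
  have closed': "x \<in> insert e D" if "y \<in> D" "x \<in> W" "(x, y) \<in> E" for x y
    using that closed symD[OF E] by blast
  have D_nbr: "\<exists>y \<in> insert e D. (x, y) \<in> E" if "x \<in> D" for x
    using that D(1) closed no_isolatedE[OF W, of x] by (metis subsetD)
  show ?thesis
  proof (cases "\<exists>d\<in>D. (d, e) \<in> E")
    case True
    then have "no_isolated E (insert e D)"
      using D_nbr symD[OF E] unfolding no_isolated_def by blast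
    moreover have "insert e D \<subset> W" using D e by blast
    ultimately obtain \<B>' where B': "decomp E P (insert e D) \<B>'" using IH by blast
    obtain X where X: "X \<in> \<B>" "e \<in> X" using decomp_vertex_bag[OF B e(1)] by blast
    obtain X' where X': "X' \<in> \<B>'" "e \<in> X'" using decomp_vertex_bag[OF B', of e] by blast
    have "decomp E P ((W - D) \<union> insert e D) (\<B> \<union> \<B>')"
      by (rule decomp_glue[OF E B B' X(1) X'(1)]) (use X X' e closed' in blast)+
    moreover have "(W - D) \<union> insert e D = W" using D e by blast
    ultimately show ?thesis by auto
  next
    case False
    then have "no_isolated E D"
      using D_nbr unfolding no_isolated_def by blast
    moreover have "D \<subset> W" using D e by blast
    ultimately obtain \<B>' where B': "decomp E P D \<B>'" using IH by blast
    obtain X where X: "X \<in> \<B>" using rip_nonempty[OF decompD(1)[OF B]] by blast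
    obtain X' where X': "X' \<in> \<B>'" using rip_nonempty[OF decompD(1)[OF B']] by blast
    have "decomp E P ((W - D) \<union> D) (\<B> \<union> \<B>')"
      by (rule decomp_glue[OF E B B' X X']) (use False closed' symD[OF E] in blast)+
    moreover have "(W - D) \<union> D = W" using D by blast
    ultimately show ?thesis by auto
  qed
qed

text \<open>The one difficult configuration of the induction: \<open>v\<close> has degree two in
  \<open>W\<close> and its neighbours are not adjacent.\<close>

locale degree2_vertex =
  fixes E :: "('a \<times> 'a) set" and W :: "'a set" and v a b :: 'a
  assumes sym: "sym E" and irrefl: "irrefl E"
    and in_W: "v \<in> W" "a \<in> W" "b \<in> W" and a_neq_b: "a \<noteq> b"
    and nbr: "\<And>y. y \<in> W \<Longrightarrow> (v, y) \<in> E \<longleftrightarrow> y = a \<or> y = b"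
    and nonadjacent: "(a, b) \<notin> E"
begin

lemma E_sym: "(x, y) \<in> E \<Longrightarrow> (y, x) \<in> E"
  using sym by (rule symD)

lemma E_neq: "(x, y) \<in> E \<Longrightarrow> x \<noteq> y"
  using irrefl by (auto simp: irrefl_def)

lemma va: "(v, a) \<in> E" and vb: "(v, b) \<in> E" and v_neq: "v \<noteq> a" "v \<noteq> b"
  using nbr in_W E_neq by blast+

text \<open>Otherwise \<open>v\<close>, \<open>a\<close>, a neighbour \<open>q\<close> of \<open>a\<close>, a connected set avoiding the neighbours of \<open>a\<close>, and \<open>b\<close>
  are the branch sets of a five-cycle.\<close>

lemma common_neighbour:
  assumes free: "C5_free E W" and D: "D \<subseteq> W - {v, a, b}" "connected_in E D"
    and y: "y \<in> D" "(y, a) \<in> E" "z \<in> D" "(z, b) \<in> E"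
  shows "\<exists>c\<in>D. (c, a) \<in> E \<and> (c, b) \<in> E"
proof (rule ccontr)
  assume none: "\<not> (\<exists>c\<in>D. (c, a) \<in> E \<and> (c, b) \<in> E)"
  \<comment> \<open>An edge from \<open>z\<close> to \<open>a\<close> would make \<open>z\<close> a
    common neighbour. So a connected set \<open>K\<close> can be grown from \<open>z\<close>
    avoiding the neighbours of \<open>a\<close>, and \<open>q\<close> is a neighbour of
    \<open>a\<close> bordering on it.\<close>
  define A where "A = {x. (x, a) \<in> E}"
  define K where "K = component E (D \<inter> - A) z"
  have zA: "z \<in> D \<inter> - A" using none y unfolding A_def by blast
  have "y \<notin> - A" using y unfolding A_def by blast
  then obtain p q where pq: "p \<in> K" "q \<in> D" "q \<in> A" "(p, q) \<in> E"
    using connected_in_exit[OF D(2) y(3) y(1), of "- A"] zA unfolding K_def by blast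
  have K: "K \<subseteq> D \<inter> - A" unfolding K_def by (rule component_subset[OF zA])
  have K_conn: "connected_in E K" unfolding K_def by (rule component_connected[OF sym])
  have zK: "z \<in> K" unfolding K_def by simp
  have qa: "(q, a) \<in> E" using pq unfolding A_def by blast
  have qb: "(q, b) \<notin> E" using none pq(2) qa by blast
  have nEv: "(v, x) \<notin> E" "(x, v) \<notin> E" if "x \<in> D" for x
    using that D(1) nbr[of x] E_sym[of x v] by auto
  have nKa: "(x, a) \<notin> E" "(a, x) \<notin> E" if "x \<in> K" for x
    using that K E_sym[of a x] unfolding A_def by auto
  have KD: "x \<in> D" "x \<noteq> v" "x \<noteq> a" "x \<noteq> b" "x \<noteq> q" if "x \<in> K" for x
    using that K D(1) pq(3) by auto
  have q: "q \<noteq> v" "q \<noteq> a" "q \<noteq> b" using pq D(1) by auto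
  \<comment> \<open>The cycle runs through \<open>v\<close>, \<open>a\<close>, \<open>q\<close>,
    \<open>K\<close>, \<open>b\<close>; on \<open>?U\<close> the default value 3 is taken exactly on
    \<open>K\<close>.\<close>
  define f where "f x = (if x = v then 0 else if x = a then 1 else if x = q then 2 else if x = b then 4 else (3::nat))" for x
  let ?U = "{v, a, q, b} \<union> K"
  have f: "f v = 0" "f a = 1" "f q = 2" "f b = 4" "\<And>x. x \<in> K \<Longrightarrow> f x = 3"
    using v_neq a_neq_b q KD unfolding f_def by auto
  have non_edges: "(v, q) \<notin> E" "(q, v) \<notin> E" "(a, b) \<notin> E" "(b, a) \<notin> E" "(q, b) \<notin> E" "(b, q) \<notin> E"
    "\<And>x. x \<in> K \<Longrightarrow> (v, x) \<notin> E" "\<And>x. x \<in> K \<Longrightarrow> (x, v) \<notin> E"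
    "\<And>x. x \<in> K \<Longrightarrow> (a, x) \<notin> E" "\<And>x. x \<in> K \<Longrightarrow> (x, a) \<notin> E"
    using nEv[OF pq(2)] nEv[OF KD(1)] nKa qb nonadjacent E_sym by blast+
  have "minor_map E ?U C5 f"
    unfolding minor_map_def
  proof (intro conjI allI ballI impI)
    show "f ` ?U = pverts C5"
      using f zK unfolding C5_verts image_Un by auto
    fix i
    have "{x \<in> ?U. f x = i} =
        (if i = 0 then {v} else if i = 1 then {a} else if i = 2 then {q} else if i = 3 then K
         else if i = 4 then {b} else {})"
      using f by auto
    then show "connected_in E {x \<in> ?U. f x = i}" using K_conn by simp
  next
    fix x y assume xy: "x \<in> ?U" "y \<in> ?U" "(x, y) \<in> E" "f x \<noteq> f y"
    show "(f x, f y) \<in> parcs C5"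
      using xy by (elim UnE insertE emptyE) (simp_all add: C5_arcs f non_edges)
  next
    fix i j assume "(i, j) \<in> parcs C5"
    then show "\<exists>x\<in>?U. \<exists>y\<in>?U. (x, y) \<in> E \<and> f x = i \<and> f y = j"
    proof -
      have "\<exists>x y. x \<in> ?U \<and> y \<in> ?U \<and> (x, y) \<in> E \<and> (y, x) \<in> E \<and> f x = i \<and> f y = j"
        if "(i, j) \<in> {(0, 1), (1, 2), (2, 3), (3, 4), (4, 0)}" for i j
      proof -
        have "(a, q) \<in> E" "(q, p) \<in> E" "(a, v) \<in> E" "(b, v) \<in> E" "(b, z) \<in> E"
          using qa pq(4) va vb y(4) E_sym by blast+
        with that va vb qa pq(4) y(4) f f(5)[OF pq(1)] f(5)[OF zK] pq(1) zK show ?thesis by blast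
      qed
      note ex = this
      have "(i, j) \<in> {(0, 1), (1, 2), (2, 3), (3, 4), (4, 0)} \<or>
          (j, i) \<in> {(0, 1), (1, 2), (2, 3), (3, 4), (4, 0)}"
        using \<open>(i, j) \<in> parcs C5\<close> unfolding C5_arcs by auto
      then show ?thesis using ex[of i j] ex[of j i] by metis
    qed
  qed
  moreover have "?U \<subseteq> W" using in_W pq(2) K D(1) by blast
  ultimately show False using free unfolding C5_free_def by blast
qed

text \<open>Two common neighbours in \<open>D\<close> would give a \<open>K\<^sub>4\<close> minor, with \<open>v\<close> subdividing the edge \<open>ab\<close>.\<close>

lemma common_neighbour_unique:
  assumes small: "decomp E small W \<B>" and D: "D \<subseteq> W - {v, a, b}" "connected_in E D"
    and c: "c \<in> D" "(c, a) \<in> E" "(c, b) \<in> E" and d: "d \<in> D" "(d, a) \<in> E" "(d, b) \<in> E"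
  shows "c = d"
proof (rule ccontr)
  assume "c \<noteq> d"
  define K where "K = component E (D \<inter> - {d}) c"
  have cD: "c \<in> D \<inter> - {d}" using c \<open>c \<noteq> d\<close> by blast
  obtain p where p: "p \<in> K" "(p, d) \<in> E"
    using connected_in_exit[OF D(2) c(1) d(1), of "- {d}"] \<open>c \<noteq> d\<close> unfolding K_def by auto
  have K: "K \<subseteq> D - {d}" "c \<in> K" "connected_in E K"
    using component_subset[OF cD] component_connected[OF sym] unfolding K_def by auto
  \<comment> \<open>Putting \<open>v\<close> into the branch set of \<open>a\<close> makes it
    adjacent to \<open>b\<close>. The four sets are disjoint and pairwise touching, so some bag has
    at least four vertices.\<close>
  let ?S = "{{v, a}, {b}, {d}, K}"
  have t: "touches E {v, a} {b}" "touches E {v, a} {d}" "touches E {v, a} K"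
    "touches E {b} {d}" "touches E {b} K" "touches E {d} K"
    using vb E_sym c d p K(2) unfolding touches_def by blast+
  note t' = t[THEN touches_sym[OF sym]]
  have r: "touches E S S" if "S \<noteq> {}" for S
    using that unfolding touches_def by blast
  have r': "touches E {v, a} {v, a}" "touches E {b} {b}" "touches E {d} {d}" "touches E K K"
    using K(2) by (intro r; blast)+
  have "\<exists>B\<in>\<B>. \<forall>S\<in>?S. S \<inter> B \<noteq> {}"
  proof (rule decomp_bramble[OF small])
    fix S assume "S \<in> ?S"
    then show "S \<noteq> {} \<and> S \<subseteq> W \<and> connected_in E S"
      using K D(1) in_W d(1) connected_in_edge[OF sym va] by auto
  next
    fix S T assume "S \<in> ?S" "T \<in> ?S"
    then show "touches E S T"
      by (elim insertE emptyE) (simp_all only: t t' r')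
  qed
  then obtain B x y where B: "B \<in> \<B>" "x \<in> {v, a}" "y \<in> K" "{x, b, d, y} \<subseteq> B" by auto
  have "x \<noteq> b" "x \<noteq> d" "x \<noteq> y" "b \<noteq> d" "b \<noteq> y" "d \<noteq> y"
    using B K(1) D(1) d(1) v_neq a_neq_b by blast+
  then have "card {x, b, d, y} = 4" by simp
  moreover have "finite B" "card B \<le> 3" using decompD(3)[OF small B(1)] by (auto simp: small_def)
  ultimately show False using card_mono[OF _ B(4)] by simp
qed

context
  fixes \<B>0
  assumes free: "C5_free E W" and small: "decomp E small W \<B>0" and no_iso: "no_isolated E W"
    and IH: "\<And>W'. W' \<subset> W \<Longrightarrow> no_isolated E W' \<Longrightarrow> \<exists>\<B>. decomp E (good E) W' \<B>"
begin

text \<open>The common neighbour \<open>c\<close> separates \<open>a\<close> from \<open>b\<close>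
  in \<open>D \<union> {a, b}\<close>. The two sides, each including \<open>c\<close>, are
  decomposed by induction; the path through \<open>a\<close>, \<open>c\<close>, \<open>b\<close> is
  a good bag that joins them and holds both \<open>a\<close> and \<open>b\<close>.\<close>

lemma component_piece:
  assumes D: "D \<subseteq> W - {v, a, b}" "connected_in E D" and c: "c \<in> D" "(c, a) \<in> E" "(c, b) \<in> E"
    and closed: "\<And>x y. x \<in> D \<Longrightarrow> y \<in> W \<Longrightarrow> (x, y) \<in> E \<Longrightarrow> y \<in> D \<union> {a, b}"
  shows "\<exists>\<B>. decomp E (good E) (D \<union> {a, b}) \<B> \<and> (\<exists>X\<in>\<B>. a \<in> X \<and> b \<in> X)"
proof -
  define R where "R = component E (insert a D - {c}) a"
  have ac: "a \<noteq> c" "b \<noteq> c" "a \<notin> D" "b \<notin> D" "v \<notin> D" using c D(1) E_neq by auto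
  have aR: "a \<in> R" unfolding R_def by simp
  have R: "R \<subseteq> insert a D - {c}"
    unfolding R_def using ac by (intro component_subset) auto
  \<comment> \<open>With an edge from the side of \<open>a\<close> to \<open>b\<close>, the
    component of \<open>x\<close> in \<open>D - {c}\<close> would be attached to both
    \<open>a\<close> and \<open>b\<close> and so contain a second common neighbour.\<close>
  have bR: "(x, b) \<notin> E" if x: "x \<in> R" for x
  proof
    assume xb: "(x, b) \<in> E"
    then have xD: "x \<in> D" "x \<noteq> c" using x R nonadjacent by auto
    have "a \<in> component E (insert a D - {c}) x"
      using component_sym[OF sym] x unfolding R_def by blast
    then have reach: "(x, a) \<in> (Restr E (insert a D - {c}))\<^sup>*"
      unfolding component_def by simp
    \<comment> \<open>Within this set the walk can leave \<open>D\<close> only to \<open>a\<close>,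
      which gives a neighbour \<open>p\<close> of \<open>a\<close> in the component of
      \<open>x\<close>.\<close>
    obtain p q where pq: "(x, p) \<in> (Restr E ((insert a D - {c}) \<inter> D))\<^sup>*" "q \<in> (insert a D - {c}) - D" "(p, q) \<in> E"
      using rtrancl_Restr_exit[OF reach xD(1) ac(3)] by metis
    have "(insert a D - {c}) \<inter> D = D - {c}" by blast
    then have p: "p \<in> component E (D - {c}) x" "(p, a) \<in> E"
      using pq unfolding component_def by auto
    let ?K = "component E (D - {c}) x"
    have K: "?K \<subseteq> D - {c}" using xD by (intro component_subset) auto
    have "\<exists>d\<in>?K. (d, a) \<in> E \<and> (d, b) \<in> E"
      using K D(1) p xb by (intro common_neighbour[OF free _ component_connected[OF sym], of _ _ p x]) auto
    then obtain d where "d \<in> D" "d \<noteq> c" "(d, a) \<in> E" "(d, b) \<in> E" using K by blast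
    then show False using common_neighbour_unique[OF small D c, of d] by blast
  qed
  have D_nbr: "\<exists>y\<in>D \<union> {a, b}. (x, y) \<in> E" if "x \<in> D" for x
    using that D(1) closed no_isolatedE[OF no_iso, of x] by (metis Diff_iff subsetD)
  have R_closed: "y \<in> R" if "x \<in> R" "(x, y) \<in> E" "y \<in> insert a D" "y \<noteq> c" for x y
    using component_closed[of x E "insert a D - {c}" a y] that R unfolding R_def by blast
  \<comment> \<open>The pieces have only \<open>c\<close> in common; its edges to \<open>a\<close>
    and \<open>b\<close> keep these three vertices from becoming isolated.\<close>
  let ?W1 = "insert c R" and ?W2 = "D \<union> {a, b} - R"
  have W1: "?W1 \<subset> W" using R D(1) in_W c(1) v_neq ac(5) by blast
  have W2: "?W2 \<subset> W" using D(1) in_W v_neq by blast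
  have "no_isolated E ?W1"
    unfolding no_isolated_def
  proof
    fix x assume x: "x \<in> ?W1"
    show "\<exists>y\<in>?W1. (x, y) \<in> E"
    proof (cases "x = c \<or> x = a")
      case True
      then show ?thesis using c(2) E_sym aR by blast
    next
      case False
      then have "x \<in> R" "x \<in> D" using x R by auto
      then obtain y where y: "y \<in> D \<union> {a, b}" "(x, y) \<in> E" using D_nbr by blast
      then have "y \<in> ?W1" using bR[OF \<open>x \<in> R\<close>] R_closed[OF \<open>x \<in> R\<close>] by auto
      then show ?thesis using y by blast
    qed
  qed
  then obtain \<B>1 where B1: "decomp E (good E) ?W1 \<B>1" using IH[OF W1] by blast
  have c_W2: "c \<in> ?W2" "b \<in> ?W2" using c R ac a_neq_b by auto
  have "no_isolated E ?W2"
    unfolding no_isolated_def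
  proof
    fix x assume x: "x \<in> ?W2"
    show "\<exists>y\<in>?W2. (x, y) \<in> E"
    proof (cases "x = c \<or> x = b")
      case True
      then show ?thesis using c(3) E_sym c_W2 by blast
    next
      case False
      then have xD: "x \<in> D" using x aR by auto
      then obtain y where y: "y \<in> D \<union> {a, b}" "(x, y) \<in> E" using D_nbr by blast
      have "y \<notin> R" using R_closed[OF _ E_sym[OF y(2)]] xD False x by auto
      then show ?thesis using y by blast
    qed
  qed
  then obtain \<B>2 where B2: "decomp E (good E) ?W2 \<B>2" using IH[OF W2] by blast
  obtain X1 where X1: "X1 \<in> \<B>1" "a \<in> X1" "c \<in> X1"
    using decomp_edge_bag[OF B1 c(2)] aR by blast
  obtain X2 where X2: "X2 \<in> \<B>2" "b \<in> X2" "c \<in> X2"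
    using decomp_edge_bag[OF B2 c(3)] c_W2 by blast
  have bR': "b \<notin> R" using R ac a_neq_b by auto
  have "decomp E (good E) {c, a, b} {{c, a, b}}"
    using good_path3[OF sym irrefl c(2,3) a_neq_b] by (rule decomp_single)
  then have "decomp E (good E) (?W1 \<union> {c, a, b}) (\<B>1 \<union> {{c, a, b}})"
  proof (rule decomp_glue[OF sym B1 _ X1(1), of _ _ "{c, a, b}"])
    show "(x, y) \<notin> E" if "x \<in> ?W1 - {c, a, b}" "y \<in> {c, a, b} - ?W1" for x y
      using that aR bR by blast
  qed (use X1 bR' ac in auto)
  then have "decomp E (good E) ((?W1 \<union> {c, a, b}) \<union> ?W2) ((\<B>1 \<union> {{c, a, b}}) \<union> \<B>2)"
  proof (rule decomp_glue[OF sym _ B2 _ X2(1), of _ _ "{c, a, b}"])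
    show "(?W1 \<union> {c, a, b}) \<inter> ?W2 \<subseteq> {c, a, b} \<inter> X2" using X2 aR by auto
    show "(x, y) \<notin> E" if "x \<in> (?W1 \<union> {c, a, b}) - ?W2" "y \<in> ?W2 - (?W1 \<union> {c, a, b})" for x y
      using that R_closed[of x y] aR c_W2 by blast
  qed auto
  moreover have "(?W1 \<union> {c, a, b}) \<union> ?W2 = D \<union> {a, b}" using R c(1) by auto
  ultimately show ?thesis by force
qed

text \<open>Components of \<open>S\<close> are split off one at a time. Each has a common neighbour
  by \<open>common\<close>, hence a decomposition with a bag containing \<open>a\<close> and
  \<open>b\<close>, along which it is glued. For empty \<open>S\<close> the bag
  \<open>{v, a, b}\<close> remains.\<close>

lemma decomp_all_components:
  assumes "finite S" "S \<subseteq> W - {v, a, b}"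
    and "\<And>x y. x \<in> S \<Longrightarrow> y \<in> W \<Longrightarrow> (x, y) \<in> E \<Longrightarrow> y \<in> S \<union> {a, b}"
    and common: "\<And>D. D \<subseteq> W - {v, a, b} \<Longrightarrow> D \<noteq> {} \<Longrightarrow> connected_in E D \<Longrightarrow>
      (\<And>x y. x \<in> D \<Longrightarrow> y \<in> W \<Longrightarrow> (x, y) \<in> E \<Longrightarrow> y \<in> D \<union> {a, b}) \<Longrightarrow> \<exists>c\<in>D. (c, a) \<in> E \<and> (c, b) \<in> E"
  shows "\<exists>\<B>. decomp E (good E) (S \<union> {v, a, b}) \<B> \<and> (\<exists>X\<in>\<B>. a \<in> X \<and> b \<in> X)"
  using assms(1-3)
proof (induction "card S" arbitrary: S rule: less_induct)
  case less
  show ?case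
  proof (cases "S = {}")
    case True
    have "decomp E (good E) {v, a, b} {{v, a, b}}"
      using good_path3[OF sym irrefl va vb a_neq_b] by (rule decomp_single)
    then show ?thesis using True by auto
  next
    case False
    then obtain x where x: "x \<in> S" by blast
    let ?D = "component E S x"
    have D: "?D \<subseteq> S" by (rule component_subset[OF x])
    have conn: "connected_in E ?D" by (rule component_connected[OF sym])
    have closed: "z \<in> ?D \<union> {a, b}" if "y \<in> ?D" "z \<in> W" "(y, z) \<in> E" for y z
      using less.prems(3)[of y z] component_closed[of y E S x z] that D by blast
    have DW: "?D \<subseteq> W - {v, a, b}" using D less.prems(2) by blast
    have "\<exists>c\<in>?D. (c, a) \<in> E \<and> (c, b) \<in> E"
      using component_self[of x E S] by (intro common[OF DW _ conn closed]) blast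
    then obtain c where c: "c \<in> ?D" "(c, a) \<in> E" "(c, b) \<in> E" by blast
    obtain \<B>1 X1 where B1: "decomp E (good E) (?D \<union> {a, b}) \<B>1" "X1 \<in> \<B>1" "a \<in> X1" "b \<in> X1"
      using component_piece[OF DW conn c] closed by blast
    have "S - ?D \<subset> S" using x component_self[of x E S] by blast
    then have "card (S - ?D) < card S" using less.prems(1) by (simp add: psubset_card_mono)
    moreover have "z \<in> (S - ?D) \<union> {a, b}" if "y \<in> S - ?D" "z \<in> W" "(y, z) \<in> E" for y z
      using that less.prems(3)[of y z] component_closed[of z E S x y] D E_sym[of y z] by blast
    ultimately obtain \<B>2 X2 where B2: "decomp E (good E) ((S - ?D) \<union> {v, a, b}) \<B>2" "X2 \<in> \<B>2" "a \<in> X2" "b \<in> X2"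
      using less.hyps[of "S - ?D"] less.prems(1,2) by blast
    have "decomp E (good E) ((?D \<union> {a, b}) \<union> ((S - ?D) \<union> {v, a, b})) (\<B>1 \<union> \<B>2)"
    proof (rule decomp_glue[OF sym B1(1) B2(1) B1(2) B2(2)])
      show "(?D \<union> {a, b}) \<inter> ((S - ?D) \<union> {v, a, b}) \<subseteq> X1 \<inter> X2"
        using DW B1 B2 by blast
      show "(y, z) \<notin> E" if "y \<in> (?D \<union> {a, b}) - ((S - ?D) \<union> {v, a, b})"
        "z \<in> ((S - ?D) \<union> {v, a, b}) - (?D \<union> {a, b})" for y z
        using that closed[of y z] less.prems(2) in_W by blast
    qed
    moreover have "(?D \<union> {a, b}) \<union> ((S - ?D) \<union> {v, a, b}) = S \<union> {v, a, b}" using D by blast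
    ultimately show ?thesis using B1 by auto
  qed
qed

lemma decomp_nonadjacent:
  assumes "finite W"
  shows "\<exists>\<B>. decomp E (good E) W \<B>"
proof (cases "\<forall>D. D \<subseteq> W - {v, a, b} \<longrightarrow> D \<noteq> {} \<longrightarrow> connected_in E D \<longrightarrow>
      (\<forall>x\<in>D. \<forall>y\<in>W. (x, y) \<in> E \<longrightarrow> y \<in> D \<union> {a, b}) \<longrightarrow> (\<exists>c\<in>D. (c, a) \<in> E \<and> (c, b) \<in> E)")
  case True
  have "y \<in> (W - {v, a, b}) \<union> {a, b}" if "x \<in> W - {v, a, b}" "y \<in> W" "(x, y) \<in> E" for x y
    using that nbr[of x] E_sym[of x y] by blast
  then have "\<exists>\<B>. decomp E (good E) ((W - {v, a, b}) \<union> {v, a, b}) \<B> \<and> (\<exists>X\<in>\<B>. a \<in> X \<and> b \<in> X)"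
    using True assms by (intro decomp_all_components) auto
  moreover have "(W - {v, a, b}) \<union> {v, a, b} = W" using in_W by blast
  ultimately show ?thesis by auto
next
  case False
  then obtain D where D: "D \<subseteq> W - {v, a, b}" "D \<noteq> {}" "connected_in E D"
    "\<And>x y. x \<in> D \<Longrightarrow> y \<in> W \<Longrightarrow> (x, y) \<in> E \<Longrightarrow> y \<in> D \<union> {a, b}" "\<not> (\<exists>c\<in>D. (c, a) \<in> E \<and> (c, b) \<in> E)"
    by blast
  \<comment> \<open>A connected set attached to both \<open>a\<close> and \<open>b\<close> would
    have a common neighbour of them, so this \<open>D\<close> is attached to at most one of the two
    and can be split off there.\<close>
  have "\<not> ((\<exists>y\<in>D. (y, a) \<in> E) \<and> (\<exists>z\<in>D. (z, b) \<in> E))"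
    using common_neighbour[OF free D(1,3)] D(5) by blast
  then obtain e where e: "e \<in> {a, b}" "\<And>x y. x \<in> D \<Longrightarrow> y \<in> W \<Longrightarrow> (x, y) \<in> E \<Longrightarrow> y \<in> insert e D"
    using D(4) by blast
  \<comment> \<open>\<open>v\<close> keeps its edges to \<open>a\<close> and \<open>b\<close>, and
    no other vertex outside \<open>D\<close> has a neighbour in \<open>D\<close>.\<close>
  have "no_isolated E (W - D)"
    unfolding no_isolated_def
  proof
    fix x assume x: "x \<in> W - D"
    show "\<exists>y \<in> W - D. (x, y) \<in> E"
    proof (cases "x \<in> {v, a, b}")
      case True
      then show ?thesis using va vb E_sym in_W D(1) by blast
    next
      case False
      obtain y where y: "y \<in> W" "(x, y) \<in> E" using no_isolatedE[OF no_iso] x by blast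
      then have "y \<notin> D" using D(4)[OF _ _ E_sym[OF y(2)]] x False by blast
      then show ?thesis using y by blast
    qed
  qed
  then show ?thesis
    using D(1) in_W e v_neq by (intro decomp_cut_vertex[OF sym IH no_iso _ D(2), of e]) auto
qed

end

end

text \<open>Decompositions into small bags and \<open>C5_free\<close> pass to subsets of
  \<open>W\<close>, so the induction hypothesis applies to every smaller set without isolated
  vertices.\<close>

theorem C5_free_imp_good_decomp:
  assumes E: "sym E" "irrefl E" and "finite W" "decomp E small W \<B>0" "C5_free E W" "no_isolated E W"
  shows "\<exists>\<B>. decomp E (good E) W \<B>"
  using assms(3-)
proof (induction "card W" arbitrary: W \<B>0 rule: less_induct)
  case less
  have IH: "\<exists>\<B>. decomp E (good E) W' \<B>" if W': "W' \<subset> W" "no_isolated E W'" for W'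
  proof -
    have "small (B \<inter> W')" if "small B" for B :: "'a set"
      using that card_mono[of B "B \<inter> W'"] by (auto simp: small_def)
    then obtain \<B>' where "decomp E small W' \<B>'"
      using decomp_restrict[OF less.prems(2), of W'] W' by blast
    moreover have "C5_free E W'" using less.prems(3) W'(1) unfolding C5_free_def by blast
    moreover have "card W' < card W" "finite W'"
      using W'(1) less.prems(1) by (auto simp: psubset_card_mono intro: finite_subset)
    ultimately show ?thesis using less.hyps W'(2) by blast
  qed
  note no_iso = less.prems(4)
  show ?case
  proof (cases "W = {}")
    case True
    then show ?thesis using decomp_single[of "good E", OF good_empty] by blast
  next
    case False
    \<comment> \<open>A vertex of degree at most two: the bag \<open>B\<close> contains all its
      neighbours together with \<open>v\<close> itself.\<close>
    obtain v B where v: "v \<in> W" "B \<in> \<B>0" "v \<in> B" "\<And>B'. B' \<in> \<B>0 \<Longrightarrow> v \<in> B' \<Longrightarrow> B' \<subseteq> B"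
      using rip_simplicial[OF decompD(1)[OF less.prems(2)] False] by metis
    define N where "N = {y \<in> W. (v, y) \<in> E}"
    have "N \<subseteq> B - {v}"
    proof
      fix y assume y: "y \<in> N"
      then obtain B' where "B' \<in> \<B>0" "v \<in> B'" "y \<in> B'"
        using decomp_edge_bag[OF less.prems(2)] v(1) unfolding N_def by blast
      then show "y \<in> B - {v}" using v(4) y E(2) unfolding N_def irrefl_def by blast
    qed
    moreover have B: "finite B" "card B \<le> 3" using decompD(3)[OF less.prems(2) v(2)] by (auto simp: small_def)
    ultimately have "card N \<le> 2" using card_mono[of "B - {v}" N] v(3) by simp
    moreover have "finite N" using less.prems(1) unfolding N_def by simp
    moreover have "N \<noteq> {}" using no_isolatedE[OF no_iso v(1)] unfolding N_def by blast
    ultimately have "card N = 1 \<or> card N = 2" by (metis One_nat_def Suc_1 card_gt_0_iff le_SucE le_antisym less_eq_Suc_le)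
    then show ?thesis
    proof
      assume "card N = 1"
      then obtain u where u: "N = {u}" by (rule card_1_singletonE)
      then have vu: "u \<in> W" "(v, u) \<in> E" "(u, v) \<in> E" "v \<noteq> u"
        using E by (auto simp: N_def irrefl_def dest: symD)
      have only_u: "y = u" if "y \<in> W" "(v, y) \<in> E \<or> (y, v) \<in> E" for y
        using that u symD[OF E(1)] unfolding N_def by blast
      have uv: "decomp E (good E) {v, u} {{v, u}}"
        using good_edge[OF E vu(2)] by (rule decomp_single)
      show ?thesis
      proof (cases "no_isolated E (W - {v})")
        case True
        then obtain \<B> where B: "decomp E (good E) (W - {v}) \<B>" using IH[of "W - {v}"] v(1) by blast
        obtain X where X: "X \<in> \<B>" "u \<in> X" using decomp_vertex_bag[OF B, of u] vu by blast
        have "decomp E (good E) ((W - {v}) \<union> {v, u}) (\<B> \<union> {{v, u}})"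
          by (rule decomp_glue[OF E(1) B uv X(1)]) (use X only_u vu in blast)+
        moreover have "(W - {v}) \<union> {v, u} = W" using v vu by blast
        ultimately show ?thesis by auto
      next
        case False
        \<comment> \<open>Removing \<open>v\<close> can isolate no vertex but \<open>u\<close>; in
          that case \<open>{v, u}\<close> is a component with a single bag.\<close>
        have u_isolated: "(u, y) \<notin> E" "(y, u) \<notin> E" if "y \<in> W" "y \<noteq> v" for y
        proof -
          obtain x where x: "x \<in> W - {v}" "\<forall>y\<in>W - {v}. (x, y) \<notin> E"
            using False unfolding no_isolated_def by blast
          obtain z where "z \<in> W" "(x, z) \<in> E" using no_isolatedE[OF no_iso, of x] x(1) by blast
          then have "x = u" using x only_u by blast
          then show "(u, y) \<notin> E" "(y, u) \<notin> E" using x(2) that symD[OF E(1)] by blast+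
        qed
        have "no_isolated E (W - {v, u})"
          unfolding no_isolated_def
        proof
          fix x assume x: "x \<in> W - {v, u}"
          then obtain y where "y \<in> W" "(x, y) \<in> E" using no_isolatedE[OF no_iso] by blast
          then show "\<exists>y \<in> W - {v, u}. (x, y) \<in> E" using x only_u u_isolated(2) by blast
        qed
        then obtain \<B> where B: "decomp E (good E) (W - {v, u}) \<B>" using IH[of "W - {v, u}"] v(1) by blast
        obtain X where X: "X \<in> \<B>" using rip_nonempty[OF decompD(1)[OF B]] by blast
        have "decomp E (good E) ((W - {v, u}) \<union> {v, u}) (\<B> \<union> {{v, u}})"
          by (rule decomp_glue[OF E(1) B uv X]) (use only_u u_isolated in blast)+
        moreover have "(W - {v, u}) \<union> {v, u} = W" using v vu by blast
        ultimately show ?thesis by auto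
      qed
    next
      assume "card N = 2"
      then obtain a b where ab: "N = {a, b}" "a \<noteq> b" unfolding card_2_iff by blast
      then have W: "a \<in> W" "b \<in> W" "(v, a) \<in> E" "(v, b) \<in> E" unfolding N_def by blast+
      have nbr: "(v, y) \<in> E \<longleftrightarrow> y = a \<or> y = b" if "y \<in> W" for y
        using that ab(1) unfolding N_def by blast
      show ?thesis
      proof (cases "(a, b) \<in> E")
        case True
        have "v \<noteq> a" "v \<noteq> b" using W E(2) by (auto simp: irrefl_def)
        \<comment> \<open>The edge \<open>ab\<close> keeps both neighbours of \<open>v\<close> from
          becoming isolated and provides a bag containing both, to which \<open>{v, a, b}\<close> is
          attached.\<close>
        have "no_isolated E (W - {v})"
          unfolding no_isolated_def
        proof
          fix x assume x: "x \<in> W - {v}"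
          then obtain y where y: "y \<in> W" "(x, y) \<in> E" using no_isolatedE[OF no_iso] by blast
          show "\<exists>y \<in> W - {v}. (x, y) \<in> E"
          proof (cases "y = v")
            case eq: True
            then have "x = a \<or> x = b" using nbr[of x] x y symD[OF E(1)] by blast
            then show ?thesis
              using True symD[OF E(1)] W \<open>v \<noteq> a\<close> \<open>v \<noteq> b\<close> by blast
          qed (use y in blast)
        qed
        then obtain \<B> where B: "decomp E (good E) (W - {v}) \<B>" using IH[of "W - {v}"] v(1) by blast
        obtain X where X: "X \<in> \<B>" "a \<in> X" "b \<in> X"
          using decomp_edge_bag[OF B True] W \<open>v \<noteq> a\<close> \<open>v \<noteq> b\<close> by blast
        have "decomp E (good E) {v, a, b} {{v, a, b}}"
          using good_path3[OF E W(3,4) ab(2)] by (rule decomp_single)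
        then have "decomp E (good E) ((W - {v}) \<union> {v, a, b}) (\<B> \<union> {{v, a, b}})"
        proof (rule decomp_glue[OF E(1) B _ X(1), of _ _ "{v, a, b}"])
          show "(x, y) \<notin> E" if "x \<in> W - {v} - {v, a, b}" "y \<in> {v, a, b} - (W - {v})" for x y
            using that nbr[of x] W \<open>v \<noteq> a\<close> \<open>v \<noteq> b\<close> symD[OF E(1), of x v] by blast
        qed (use X in auto)
        moreover have "(W - {v}) \<union> {v, a, b} = W" using v W by blast
        ultimately show ?thesis by auto
      next
        case False
        interpret degree2_vertex E W v a b
          by unfold_locales (use E v W ab nbr False in auto)
        show ?thesis
          by (rule decomp_nonadjacent[OF less.prems(3,2) no_iso IH less.prems(1)])
      qed
    qed
  qed
qed

theorem theorem8:
  fixes G :: "'a pair_pre_digraph"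
  assumes "partial_2_tree G"
    and "no_isolated_vertices G"
  shows "induced_minor_free C5 G \<longleftrightarrow> mtw G \<le> 2"
proof -
  have G: "pair_graph G" "treewidth G \<le> 2"
    using assms(1) by (auto simp: partial_2_tree_def)
  have E: "finite (pverts G)" "parcs G \<subseteq> pverts G \<times> pverts G" "sym (parcs G)" "irrefl (parcs G)"
    using G(1) unfolding pair_graph_iff by auto
  have no_iso: "no_isolated (parcs G) (pverts G)"
    using assms(2) E(2) unfolding no_isolated_vertices_def no_isolated_def by blast
  have free: "induced_minor_free C5 G \<longleftrightarrow> C5_free (parcs G) (pverts G)"
    unfolding induced_minor_free_def C5_free_def induced_minor_iff_minor_map[OF G(1) pair_graph_C5] ..
  show ?thesis
    unfolding free mtw_le_2_iff[OF G(1)]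
  proof
    assume "C5_free (parcs G) (pverts G)"
    then show "\<exists>\<B>. decomp (parcs G) (good (parcs G)) (pverts G) \<B>"
      using C5_free_imp_good_decomp[OF E(3,4,1) _ _ no_iso] treewidth_le_2_iff[OF G(1)] G(2) by blast
  next
    assume "\<exists>\<B>. decomp (parcs G) (good (parcs G)) (pverts G) \<B>"
    then show "C5_free (parcs G) (pverts G)"
      using good_decomp_no_C5[OF E(3)] unfolding C5_free_def by blast
  qed
qed

end
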